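(* Assume that $a\in L^2(x_0,\infty)$, $a(pa')'\in L^1(x_0,\infty)$ and $\lim_{x\to\infty}p(x)a'(x)a(x)=0$. Then for every $z\in\mathbb{C}$ the solutions $\varphi_z(x)$ and $\theta_z(x)$ of the equation $-(pu')'-qu=zu$ have asymptotics $$\varphi_z(x)=a(x)\big(\sigma_+(z)e^{i\Xi(x)}+\sigma_-(z)e^{-i\Xi(x)}+o(1)\big),$$ $$\theta_z(x)=a(x)\big(\tau_+(z)e^{i\Xi(x)}+\tau_-(z)e^{-i\Xi(x)}+o(1)\big)$$ as $x\to\infty$. These asymptotic formulas can be differentiated in $x$, that is, $$\varphi_z'(x)=i\xi(x)a(x)\big(\sigma_+(z)e^{i\Xi(x)}-\sigma_-(z)e^{-i\Xi(x)}+o(1)\big),$$ $$\theta_z'(x)=i\xi(x)a(x)\big(\tau_+(z)e^{i\Xi(x)}-\tau_-(z)e^{-i\Xi(x)}+o(1)\big)$$ as $x\to\infty$.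
   Context: $\mathbb{R}_+=(0,\infty)$. Standing assumptions: $p\in C^1(\mathbb{R}_+)$ and $q\in C(\mathbb{R}_+)$ are real-valued with finite limits as $x\to0$, and $p(x)>0$ for all $x\ge0$. Fix $x_0>0$ with $q(x)>0$ for $x\ge x_0$; for $x\ge x_0$ put $a(x)=(p(x)q(x))^{-1/4}$, $\xi(x)=\sqrt{q(x)/p(x)}$, $\Xi(x)=\int_{x_0}^x\xi(y)\,dy$, where $a\in C^1([x_0,\infty))$ with $a'$ locally absolutely continuous. Regular solutions: fix $\alpha\in\mathbb{R}\cup\{\infty\}$. For $z\in\mathbb{C}$, $\varphi_z,\theta_z$ are the solutions of $-(pu')'-qu=zu$ on $\mathbb{R}_+$ with, if $\alpha\in\mathbb{R}$: $\varphi_z(0)=1,\ \varphi_z'(0)=\alpha,\ \theta_z(0)=0,\ \theta_z'(0)=-p(0)^{-1}$; if $\alpha=\infty$: $\varphi_z(0)=0,\ \varphi_z'(0)=1,\ \theta_z(0)=p(0)^{-1},\ \theta_z'(0)=0$ (values at $0$ are limits as $x\to+0$). Jost solution: $f_z$ is the unique solution of $-(pu')'-qu=zu$ on $\mathbb{R}_+$ with $f_z(x)=a(x)e^{i\Xi(x)}(1+o(1))$ and $f_z'(x)=i\xi(x)a(x)e^{i\Xi(x)}(1+o(1))$ as $x\to\infty$; it exists under the assumptions of the claim. The functions $f_z(x)$ and $\overline{f_{\bar z}(x)}$ are linearly independent solutions, and $\sigma_\pm(z),\tau_\pm(z)\in\mathbb{C}$ are defined by $\varphi_z=\sigma_+(z)f_z+\sigma_-(z)\overline{f_{\bar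 z}}$, $\theta_z=\tau_+(z)f_z+\tau_-(z)\overline{f_{\bar z}}$. *)

theory Defs
  imports "HOL-Analysis.Analysis"
begin

text \<open>
  The coefficients are functions \<open>p q :: real \<Rightarrow> real\<close>; only their values on \<open>(0, \<infinity>)\<close> matter,
  together with \<open>p 0\<close> and \<open>q 0\<close>, which stand for the limits at \<open>0\<close> from the right.
\<close>

definition amp :: "(real \<Rightarrow> real) \<Rightarrow> (real \<Rightarrow> real) \<Rightarrow> real \<Rightarrow> real" where
  "amp p q x = (p x * q x) powr (- 1 / 4)"

definition xi :: "(real \<Rightarrow> real) \<Rightarrow> (real \<Rightarrow> real) \<Rightarrow> real \<Rightarrow> real" where
  "xi p q x = sqrt (q x / p x)"

definition Xi :: "(real \<Rightarrow> real) \<Rightarrow> (real \<Rightarrow> real) \<Rightarrow> real \<Rightarrow> real \<Rightarrow> real" where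
  "Xi p q x0 x = integral {x0..x} (xi p q)"

text \<open>The usual \<open>\<epsilon>\<close>-\<open>\<delta>\<close> notion; a division is a finite family of non-overlapping compact intervals.\<close>

definition abs_continuous_on :: "real set \<Rightarrow> (real \<Rightarrow> real) \<Rightarrow> bool" where
  "abs_continuous_on S f \<longleftrightarrow>
     (\<forall>\<epsilon>>0. \<exists>\<delta>>0. \<forall>\<D> T. \<D> division_of T \<longrightarrow> T \<subseteq> S \<longrightarrow> (\<Sum>K\<in>\<D>. Sup K - Inf K) < \<delta> \<longrightarrow>
        (\<Sum>K\<in>\<D>. \<bar>f (Sup K) - f (Inf K)\<bar>) < \<epsilon>)"

definition locally_abs_continuous_on :: "real set \<Rightarrow> (real \<Rightarrow> real) \<Rightarrow> bool" where
  "locally_abs_continuous_on S f \<longleftrightarrow> (\<forall>c d. {c..d} \<subseteq> S \<longrightarrow> abs_continuous_on {c..d} f)"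

text \<open>
  A locally absolutely continuous function is differentiable only almost everywhere, so its
  derivative is a function determined up to a null set.
\<close>

definition has_ae_derivative_on :: "(real \<Rightarrow> real) \<Rightarrow> (real \<Rightarrow> real) \<Rightarrow> real set \<Rightarrow> bool" where
  "has_ae_derivative_on F h S \<longleftrightarrow>
     (AE x in lebesgue. x \<in> S \<longrightarrow> (F has_real_derivative h x) (at x))"

text \<open>
  Solutions of \<open>- (p u')' - q u = z u\<close> on \<open>(0, \<infinity>)\<close>. They are normalised to be \<open>extensional\<close>,
  so that uniqueness on \<open>(0, \<infinity>)\<close> is uniqueness as HOL functions.
\<close>

definition solution ::
    "(real \<Rightarrow> real) \<Rightarrow> (real \<Rightarrow> real) \<Rightarrow> complex \<Rightarrow> (real \<Rightarrow> complex) \<Rightarrow> bool" where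
  "solution p q z u \<longleftrightarrow>
     u \<in> extensional {0<..} \<and>
     (\<forall>x>0. u differentiable at x \<and>
        (\<lambda>y. of_real (p y) * vector_derivative u (at y)) differentiable at x \<and>
        - vector_derivative (\<lambda>y. of_real (p y) * vector_derivative u (at y)) (at x)
          - of_real (q x) * u x = z * u x)"

definition initial_values :: "(real \<Rightarrow> complex) \<Rightarrow> complex \<Rightarrow> complex \<Rightarrow> bool" where
  "initial_values u c d \<longleftrightarrow>
     (u \<longlongrightarrow> c) (at_right 0) \<and> ((\<lambda>x. vector_derivative u (at x)) \<longlongrightarrow> d) (at_right 0)"

text \<open>The boundary parameter \<open>\<alpha> \<in> \<real> \<union> {\<infinity>}\<close> (a single point at infinity, unlike \<open>ereal\<close>).\<close>

datatype boundary_param = Finite real | Infinite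

definition phi ::
    "(real \<Rightarrow> real) \<Rightarrow> (real \<Rightarrow> real) \<Rightarrow> boundary_param \<Rightarrow> complex \<Rightarrow> real \<Rightarrow> complex" where
  "phi p q \<alpha> z = (THE u. solution p q z u \<and>
     (case \<alpha> of Finite r \<Rightarrow> initial_values u 1 (of_real r)
              | Infinite \<Rightarrow> initial_values u 0 1))"

definition theta ::
    "(real \<Rightarrow> real) \<Rightarrow> (real \<Rightarrow> real) \<Rightarrow> boundary_param \<Rightarrow> complex \<Rightarrow> real \<Rightarrow> complex" where
  "theta p q \<alpha> z = (THE u. solution p q z u \<and>
     (case \<alpha> of Finite r \<Rightarrow> initial_values u 0 (of_real (- inverse (p 0)))
              | Infinite \<Rightarrow> initial_values u (of_real (inverse (p 0))) 0))"

definition is_jost ::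
    "(real \<Rightarrow> real) \<Rightarrow> (real \<Rightarrow> real) \<Rightarrow> real \<Rightarrow> complex \<Rightarrow> (real \<Rightarrow> complex) \<Rightarrow> bool" where
  "is_jost p q x0 z f \<longleftrightarrow>
     solution p q z f \<and>
     (\<exists>\<epsilon>. (\<epsilon> \<longlongrightarrow> 0) at_top \<and> (\<forall>x\<ge>x0.
        f x = of_real (amp p q x) * exp (\<i> * of_real (Xi p q x0 x)) * (1 + \<epsilon> x))) \<and>
     (\<exists>\<epsilon>. (\<epsilon> \<longlongrightarrow> 0) at_top \<and> (\<forall>x\<ge>x0.
        vector_derivative f (at x) =
          \<i> * of_real (xi p q x) * of_real (amp p q x) * exp (\<i> * of_real (Xi p q x0 x)) * (1 + \<epsilon> x)))"

definition jost ::
    "(real \<Rightarrow> real) \<Rightarrow> (real \<Rightarrow> real) \<Rightarrow> real \<Rightarrow> complex \<Rightarrow> real \<Rightarrow> complex" where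
  "jost p q x0 z = (THE f. is_jost p q x0 z f)"

definition jost_coeffs ::
    "(real \<Rightarrow> real) \<Rightarrow> (real \<Rightarrow> real) \<Rightarrow> real \<Rightarrow> complex \<Rightarrow> (real \<Rightarrow> complex) \<Rightarrow> complex \<times> complex" where
  "jost_coeffs p q x0 z u = (THE c. \<forall>x>0.
     u x = fst c * jost p q x0 z x + snd c * cnj (jost p q x0 (cnj z) x))"

definition sigma_plus ::
    "(real \<Rightarrow> real) \<Rightarrow> (real \<Rightarrow> real) \<Rightarrow> real \<Rightarrow> boundary_param \<Rightarrow> complex \<Rightarrow> complex" where
  "sigma_plus p q x0 \<alpha> z = fst (jost_coeffs p q x0 z (phi p q \<alpha> z))"

definition sigma_minus ::
    "(real \<Rightarrow> real) \<Rightarrow> (real \<Rightarrow> real) \<Rightarrow> real \<Rightarrow> boundary_param \<Rightarrow> complex \<Rightarrow> complex" where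
  "sigma_minus p q x0 \<alpha> z = snd (jost_coeffs p q x0 z (phi p q \<alpha> z))"

definition tau_plus ::
    "(real \<Rightarrow> real) \<Rightarrow> (real \<Rightarrow> real) \<Rightarrow> real \<Rightarrow> boundary_param \<Rightarrow> complex \<Rightarrow> complex" where
  "tau_plus p q x0 \<alpha> z = fst (jost_coeffs p q x0 z (theta p q \<alpha> z))"

definition tau_minus ::
    "(real \<Rightarrow> real) \<Rightarrow> (real \<Rightarrow> real) \<Rightarrow> real \<Rightarrow> boundary_param \<Rightarrow> complex \<Rightarrow> complex" where
  "tau_minus p q x0 \<alpha> z = snd (jost_coeffs p q x0 z (theta p q \<alpha> z))"

end

theory Submission
  imports Defs
begin

text \<open>
  Write \<open>a = amp p q\<close> and \<open>\<Xi> = Xi p q x0\<close>. The functions \<open>a exp (\<plusminus>\<i>\<Xi>)\<close> are the leading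
  Liouville--Green approximations: applying the differential expression to them leaves, up to
  sign, the error \<open>(p a')' exp (\<plusminus>\<i>\<Xi>)\<close>. Variation of parameters relative to them turns a solution \<open>u\<close> with
  quasi-derivative \<open>v = p u'\<close> into a pair of coefficients \<open>c\<^sub>+, c\<^sub>-\<close> with
  \<open>u = a (c\<^sub>+ exp (\<i>\<Xi>) + c\<^sub>- exp (-\<i>\<Xi>))\<close>, and the equation becomes

  \<open>c\<^sub>\<plusminus>' = \<plusminus>(\<i>/2) exp (\<mp>\<i>\<Xi>) (z a + (p a')') u\<close>,

  whose right-hand side is bounded in modulus by \<open>\<bar>z a\<^sup>2 + a (p a')'\<bar> (\<bar>c\<^sub>+\<bar> + \<bar>c\<^sub>-\<bar>) / 2\<close>. The weight
  \<open>\<bar>z a\<^sup>2 + a (p a')'\<bar>\<close> is integrable by the two integrability hypotheses, so the coefficients of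
  every solution are bounded and converge at infinity (\<open>coef_convergent\<close>). In turn, convergence
  to \<open>L\<^sub>+, L\<^sub>-\<close> gives the two asymptotic formulas with these constants; the hypothesis
  \<open>p a' a \<longrightarrow> 0\<close> enters in the formula for the derivative (\<open>solution_asymptotics\<close>).

  What remains is to identify the limits with the coefficients in the expansion by Jost solutions.
  In these terms the Jost solution \<open>f\<close> is the solution whose coefficients tend to \<open>(1, 0)\<close>, and
  the conjugate \<open>g\<close> of the Jost solution at the conjugate spectral parameter is the one with
  limits \<open>(0, 1)\<close>; hence the limits of \<open>\<sigma>\<^sub>+ f + \<sigma>\<^sub>- g\<close> are \<open>(\<sigma>\<^sub>+, \<sigma>\<^sub>-)\<close> (\<open>jost_coeffs_limits\<close>). The claims of existence and uniqueness
  behind the definite descriptions rest on one mechanism: the Wronskian of two solutions is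
  constant, and equals \<open>-2\<i>\<close> times the determinant of their limits at infinity
  (\<open>wronskian_limits\<close>). Thus the map from solutions to limits is an isomorphism of the
  two-dimensional solution space, and the Jost solution is obtained by inverting it, with no
  integral equation from infinity. The same constancy, evaluated at the left endpoint, gives
  uniqueness in the initial value problem; its existence is a fixed point of a Volterra operator
  (\<open>linear_volterra_ivp\<close>).

  The derivative of \<open>p a'\<close> exists only almost everywhere, so the equations for the coefficients
  have to be integrated by the fundamental theorem of calculus for absolutely continuous
  functions, which is proved first.
\<close>

section \<open>Absolutely continuous functions with values in a normed space\<close>

text \<open>
  The vector-valued form of absolute continuity is needed because the coefficients studied below
  are complex.
\<close>

definition abs_cont_on :: "real set \<Rightarrow> (real \<Rightarrow> 'a::real_normed_vector) \<Rightarrow> bool" where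
  "abs_cont_on S f \<longleftrightarrow>
     (\<forall>\<epsilon>>0. \<exists>\<delta>>0. \<forall>\<D> T. \<D> division_of T \<longrightarrow> T \<subseteq> S \<longrightarrow> (\<Sum>K\<in>\<D>. Sup K - Inf K) < \<delta> \<longrightarrow>
        (\<Sum>K\<in>\<D>. norm (f (Sup K) - f (Inf K))) < \<epsilon>)"

lemma abs_cont_on_of_real:
  "abs_continuous_on S f \<Longrightarrow> abs_cont_on S (\<lambda>x. of_real (f x) :: 'a::real_normed_algebra_1)"
  unfolding abs_continuous_on_def abs_cont_on_def
  by (simp flip: of_real_diff)

lemma division_of_endpoints:
  fixes T :: "real set"
  assumes "\<D> division_of T" "T \<subseteq> S" "K \<in> \<D>"
  shows "Inf K \<in> S" "Sup K \<in> S" "Inf K \<le> Sup K"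
proof -
  obtain u v where "K = {u..v}" "K \<noteq> {}" "K \<subseteq> S"
    using assms by (metis box_real(2) division_ofD(2,3,4) subset_trans)
  then show "Inf K \<in> S" "Sup K \<in> S" "Inf K \<le> Sup K"
    by (auto simp: subset_iff)
qed

text \<open>
  The common reason behind all closure properties: the increments of \<open>k\<close> over a division are
  controlled by those of \<open>f\<close> and \<open>g\<close>.
\<close>

lemma abs_cont_on_dominated:
  assumes f: "abs_cont_on S f" and g: "abs_cont_on S g"
    and bd: "\<And>x y. x \<in> S \<Longrightarrow> y \<in> S \<Longrightarrow>
               norm (k y - k x) \<le> B * norm (f y - f x) + B * norm (g y - g x)"
  shows "abs_cont_on S k"
  unfolding abs_cont_on_def
proof (intro allI impI)
  fix \<epsilon> :: real assume "\<epsilon> > 0"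
  define B' where "B' = \<bar>B\<bar> + 1"
  have B': "B' > 0" "B \<le> B'" unfolding B'_def by auto
  define \<eta> where "\<eta> = \<epsilon> / (2 * B')"
  have "\<eta> > 0" unfolding \<eta>_def using \<open>\<epsilon> > 0\<close> B' by simp
  obtain d1 where d1: "d1 > 0" "\<And>\<D> T. \<D> division_of T \<Longrightarrow> T \<subseteq> S \<Longrightarrow>
      (\<Sum>K\<in>\<D>. Sup K - Inf K) < d1 \<Longrightarrow> (\<Sum>K\<in>\<D>. norm (f (Sup K) - f (Inf K))) < \<eta>"
    using f \<open>\<eta> > 0\<close> unfolding abs_cont_on_def by blast
  obtain d2 where d2: "d2 > 0" "\<And>\<D> T. \<D> division_of T \<Longrightarrow> T \<subseteq> S \<Longrightarrow>
      (\<Sum>K\<in>\<D>. Sup K - Inf K) < d2 \<Longrightarrow> (\<Sum>K\<in>\<D>. norm (g (Sup K) - g (Inf K))) < \<eta>"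
    using g \<open>\<eta> > 0\<close> unfolding abs_cont_on_def by blast
  show "\<exists>\<delta>>0. \<forall>\<D> T. \<D> division_of T \<longrightarrow> T \<subseteq> S \<longrightarrow> (\<Sum>K\<in>\<D>. Sup K - Inf K) < \<delta> \<longrightarrow>
      (\<Sum>K\<in>\<D>. norm (k (Sup K) - k (Inf K))) < \<epsilon>"
  proof (intro exI[of _ "min d1 d2"] conjI allI impI)
    fix \<D> T assume D: "\<D> division_of T" "T \<subseteq> S" and "(\<Sum>K\<in>\<D>. Sup K - Inf K) < min d1 d2"
    then have F: "(\<Sum>K\<in>\<D>. norm (f (Sup K) - f (Inf K))) < \<eta>"
      and G: "(\<Sum>K\<in>\<D>. norm (g (Sup K) - g (Inf K))) < \<eta>"
      using d1(2) d2(2) by auto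
    have "(\<Sum>K\<in>\<D>. norm (k (Sup K) - k (Inf K)))
        \<le> (\<Sum>K\<in>\<D>. B' * norm (f (Sup K) - f (Inf K)) + B' * norm (g (Sup K) - g (Inf K)))"
    proof (rule sum_mono)
      fix K assume "K \<in> \<D>"
      from bd[OF division_of_endpoints(1,2)[OF D this]]
      have "norm (k (Sup K) - k (Inf K))
          \<le> B * norm (f (Sup K) - f (Inf K)) + B * norm (g (Sup K) - g (Inf K))" .
      also have "\<dots> \<le> B' * norm (f (Sup K) - f (Inf K)) + B' * norm (g (Sup K) - g (Inf K))"
        using B' by (intro add_mono mult_right_mono) auto
      finally show "norm (k (Sup K) - k (Inf K))
          \<le> B' * norm (f (Sup K) - f (Inf K)) + B' * norm (g (Sup K) - g (Inf K))" .
    qed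
    also have "\<dots> = B' * (\<Sum>K\<in>\<D>. norm (f (Sup K) - f (Inf K)))
        + B' * (\<Sum>K\<in>\<D>. norm (g (Sup K) - g (Inf K)))"
      by (simp add: sum.distrib sum_distrib_left)
    also have "\<dots> < B' * \<eta> + B' * \<eta>"
      using F G B' by (intro add_strict_mono mult_strict_left_mono) auto
    also have "\<dots> = \<epsilon>" unfolding \<eta>_def using B' by (simp add: field_simps)
    finally show "(\<Sum>K\<in>\<D>. norm (k (Sup K) - k (Inf K))) < \<epsilon>" .
  qed (use d1 d2 in auto)
qed

lemma abs_cont_on_add:
  assumes "abs_cont_on S f" "abs_cont_on S g"
  shows "abs_cont_on S (\<lambda>x. f x + g x)"
  by (rule abs_cont_on_dominated[OF assms, where B = 1])
     (metis add_diff_add mult_1 norm_triangle_ineq)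

lemma abs_cont_on_mult:
  fixes f g :: "real \<Rightarrow> 'a::real_normed_algebra"
  assumes f: "abs_cont_on S f" and g: "abs_cont_on S g"
    and bf: "bounded (f ` S)" and bg: "bounded (g ` S)"
  shows "abs_cont_on S (\<lambda>x. f x * g x)"
proof -
  obtain B1 B2 where B1: "\<And>x. x \<in> S \<Longrightarrow> norm (f x) \<le> B1" and B2: "\<And>x. x \<in> S \<Longrightarrow> norm (g x) \<le> B2"
    using bf bg unfolding bounded_iff by auto
  show ?thesis
  proof (rule abs_cont_on_dominated[OF f g, where B = "max B1 B2"])
    fix x y assume "x \<in> S" "y \<in> S"
    have "norm (f y * g y - f x * g x) = norm ((f y - f x) * g y + f x * (g y - g x))"
      by (simp add: algebra_simps)
    also have "\<dots> \<le> norm (f y - f x) * norm (g y) + norm (f x) * norm (g y - g x)"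
      by (meson add_mono norm_mult_ineq norm_triangle_le)
    also have "\<dots> \<le> norm (f y - f x) * max B1 B2 + max B1 B2 * norm (g y - g x)"
      using B1[OF \<open>x \<in> S\<close>] B2[OF \<open>y \<in> S\<close>] by (intro add_mono mult_left_mono mult_right_mono) auto
    finally show "norm (f y * g y - f x * g x)
        \<le> max B1 B2 * norm (f y - f x) + max B1 B2 * norm (g y - g x)"
      by (simp add: mult.commute)
  qed
qed

lemma abs_cont_on_lipschitz:
  assumes "\<And>x y. x \<in> S \<Longrightarrow> y \<in> S \<Longrightarrow> norm (f y - f x) \<le> B * \<bar>y - x\<bar>"
  shows "abs_cont_on S f"
proof -
  have "abs_cont_on S (\<lambda>x. x :: real)"
    unfolding abs_cont_on_def
  proof (intro allI impI)
    fix \<epsilon> :: real assume "\<epsilon> > 0"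
    show "\<exists>\<delta>>0. \<forall>\<D> T. \<D> division_of T \<longrightarrow> T \<subseteq> S \<longrightarrow> (\<Sum>K\<in>\<D>. Sup K - Inf K) < \<delta> \<longrightarrow>
        (\<Sum>K\<in>\<D>. norm (Sup K - Inf K :: real)) < \<epsilon>"
    proof (intro exI[of _ \<epsilon>] conjI allI impI)
      fix \<D> T assume D: "\<D> division_of T" "T \<subseteq> S" "(\<Sum>K\<in>\<D>. Sup K - Inf K) < \<epsilon>"
      have "(\<Sum>K\<in>\<D>. norm (Sup K - Inf K :: real)) = (\<Sum>K\<in>\<D>. Sup K - Inf K)"
        using division_of_endpoints(3)[OF D(1,2)] by (intro sum.cong) auto
      with D(3) show "(\<Sum>K\<in>\<D>. norm (Sup K - Inf K :: real)) < \<epsilon>" by simp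
    qed fact
  qed
  from this this show ?thesis
    by (rule abs_cont_on_dominated[where B = "\<bar>B\<bar>"])
       (smt (verit, best) assms mult_right_mono abs_ge_zero real_norm_def mult_nonneg_nonneg)
qed

lemma abs_cont_on_C1:
  fixes f :: "real \<Rightarrow> 'a::real_normed_vector"
  assumes f: "\<And>x. x \<in> {c..d} \<Longrightarrow> (f has_vector_derivative f' x) (at x within {c..d})"
    and f': "continuous_on {c..d} f'"
  shows "abs_cont_on {c..d} f"
proof -
  obtain B where B: "\<And>x. x \<in> {c..d} \<Longrightarrow> norm (f' x) \<le> B"
    using compact_imp_bounded[OF compact_continuous_image[OF f' compact_Icc]]
    unfolding bounded_iff by blast
  show ?thesis
  proof (rule abs_cont_on_lipschitz)
    fix x y assume xy: "x \<in> {c..d}" "y \<in> {c..d}"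
    have "norm (f y - f x) \<le> B * norm (y - x)"
    proof (rule differentiable_bound[OF convex_real_interval(5)])
      fix t assume t: "t \<in> {c..d}"
      show "(f has_derivative (\<lambda>h. h *\<^sub>R f' t)) (at t within {c..d})"
        using f[OF t] by (simp add: has_vector_derivative_def)
      show "onorm (\<lambda>h. h *\<^sub>R f' t) \<le> B"
        using B[OF t] by (simp add: onorm_scaleR_left onorm_id)
    qed (use xy in auto)
    then show "norm (f y - f x) \<le> B * \<bar>y - x\<bar>" by simp
  qed
qed

lemma abs_cont_on_imp_continuous_on:
  assumes f: "abs_cont_on {c..d} f"
  shows "continuous_on {c..d} f"
  unfolding continuous_on_iff
proof (intro ballI allI impI)
  fix x \<epsilon> :: real assume x: "x \<in> {c..d}" and "\<epsilon> > 0"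
  then obtain \<delta> where \<delta>: "\<delta> > 0" "\<And>\<D> T. \<D> division_of T \<Longrightarrow> T \<subseteq> {c..d} \<Longrightarrow>
        (\<Sum>K\<in>\<D>. Sup K - Inf K) < \<delta> \<Longrightarrow> (\<Sum>K\<in>\<D>. norm (f (Sup K) - f (Inf K))) < \<epsilon>"
    using f unfolding abs_cont_on_def by metis
  \<comment> \<open>Absolute continuity is applied to the division that consists of one interval.\<close>
  have near: "norm (f t - f s) < \<epsilon>" if "s \<le> t" "t - s < \<delta>" "s \<in> {c..d}" "t \<in> {c..d}" for s t
  proof -
    have "{{s..t}} division_of {s..t}"
      using division_of_self[of s t] that by simp
    from \<delta>(2)[OF this] that show ?thesis by auto
  qed
  show "\<exists>\<delta>>0. \<forall>x'\<in>{c..d}. dist x' x < \<delta> \<longrightarrow> dist (f x') (f x) < \<epsilon>"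
  proof (intro exI[of _ \<delta>] conjI ballI impI)
    fix y assume "y \<in> {c..d}" "dist y x < \<delta>"
    then show "dist (f y) (f x) < \<epsilon>"
      using near[of x y] near[of y x] x
      by (cases "x \<le> y") (auto simp: dist_norm norm_minus_commute)
  qed fact
qed

lemma abs_cont_on_mult_Icc:
  fixes f g :: "real \<Rightarrow> 'a::real_normed_algebra"
  assumes "abs_cont_on {c..d} f" "abs_cont_on {c..d} g"
  shows "abs_cont_on {c..d} (\<lambda>x. f x * g x)"
  using assms
  by (intro abs_cont_on_mult compact_imp_bounded compact_continuous_image abs_cont_on_imp_continuous_on) auto

text \<open>
  A gauge proof. At a point of differentiability the gauge makes the Riemann term match the
  increment of \<open>F\<close> up to a small multiple of the length of the interval. At a point of the null
  set the integrand may be taken to be zero and the gauge confines the interval to an open set of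
  small measure that covers the null set; the intervals tagged there have small total length, so
  absolute continuity makes the sum of the increments of \<open>F\<close> over them small.
\<close>

lemma fundamental_theorem_of_calculus_abs_cont:
  fixes F :: "real \<Rightarrow> 'a::banach"
  assumes "c \<le> d" and ac: "abs_cont_on {c..d} F" and N: "negligible N"
    and der: "\<And>x. x \<in> {c..d} - N \<Longrightarrow> (F has_vector_derivative f x) (at x within {c..d})"
  shows "(f has_integral (F d - F c)) {c..d}"
proof -
  define g where "g x = (if x \<in> N then 0 else f x)" for x
  have *: "(g has_integral (F d - F c)) {c..d}"
    unfolding has_integral_real
  proof (intro allI impI)
    fix \<epsilon> :: real assume "\<epsilon> > 0"
    \<comment> \<open>The summand 1 avoids a division by zero when \<open>c = d\<close>.\<close>
    define e where "e = \<epsilon> / (2 * (d - c + 1))"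
    have e: "e > 0" "e * (d - c) < \<epsilon> / 2"
      using \<open>\<epsilon> > 0\<close> \<open>c \<le> d\<close> by (auto simp: e_def field_simps)
    have "\<forall>x. \<exists>\<delta>>0. x \<in> {c..d} - N \<longrightarrow>
         (\<forall>y\<in>{c..d}. norm (y-x) < \<delta> \<longrightarrow> norm (F y - F x - (y-x) *\<^sub>R f x) \<le> e * norm (y-x))"
      using der[unfolded has_vector_derivative_def has_derivative_within_alt] e
      by (metis DiffD1 zero_less_one)
    then obtain r where r: "\<And>x. 0 < r x"
        "\<And>x y. \<lbrakk>x \<in> {c..d} - N; y \<in> {c..d}; norm (y-x) < r x\<rbrakk>
           \<Longrightarrow> norm (F y - F x - (y-x) *\<^sub>R f x) \<le> e * norm (y-x)"
      by metis
    obtain \<delta> where \<delta>: "\<delta> > 0" "\<And>\<D> T. \<D> division_of T \<Longrightarrow> T \<subseteq> {c..d} \<Longrightarrow>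
        (\<Sum>K\<in>\<D>. Sup K - Inf K) < \<delta> \<Longrightarrow> (\<Sum>K\<in>\<D>. norm (F (Sup K) - F (Inf K))) < \<epsilon> / 2"
      using ac \<open>\<epsilon> > 0\<close> unfolding abs_cont_on_def by (metis half_gt_zero)
    have N0: "N \<in> null_sets lebesgue" using N by (simp add: negligible_iff_null_sets)
    then have "N \<in> sets lebesgue" by auto
    from sets_lebesgue_outer_open[OF this \<open>\<delta> > 0\<close>] obtain U where U:
      "open U" "N \<subseteq> U" "U - N \<in> lmeasurable" "emeasure lebesgue (U - N) < ennreal \<delta>" by metis
    have Um: "U \<in> lmeasurable"
      using U(2,3) N0 by (metis Un_Diff_cancel2 Un_absorb2 fmeasurable.Un null_setsD1 null_setsD2 fmeasurableI_null_sets)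
    have "emeasure lebesgue U < ennreal \<delta>"
      using U(1,4) N0 by (simp add: emeasure_Diff_null_set)
    then have Ulm: "measure lebesgue U < \<delta>"
      using Um \<open>\<delta> > 0\<close> by (simp add: emeasure_eq_measure2 ennreal_less_iff)
    define \<gamma> where "\<gamma> x = (if x \<in> N then U else ball x (r x))" for x
    have "gauge \<gamma>"
      using U r(1) unfolding gauge_def \<gamma>_def by auto
    moreover have "norm ((\<Sum>(x, K)\<in>p. measure lborel K *\<^sub>R g x) - (F d - F c)) < \<epsilon>"
      if p: "p tagged_division_of {c..d}" and fine: "\<gamma> fine p" for p
    proof -
      have finp: "finite p" using p by blast
      define p1 p2 where "p1 = {(x,K) \<in> p. x \<in> N}" and "p2 = {(x,K) \<in> p. x \<notin> N}"
      have sp: "p = p1 \<union> p2" "p1 \<inter> p2 = {}" "finite p1" "finite p2"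
        using finp unfolding p1_def p2_def by (auto intro: finite_subset)
      have Kuv: "\<exists>u v. u \<le> v \<and> K = {u..v} \<and> x \<in> K \<and> K \<subseteq> {c..d}" if "(x, K) \<in> p" for x K
        using tagged_division_ofD(2-4)[OF p that] by (metis atLeastAtMost_iff box_real(2) order_trans)
      define D where "D = (\<lambda>(x :: real, K). measure lborel K *\<^sub>R g x - (F (Sup K) - F (Inf K)))"
      have "(\<Sum>(x, K)\<in>p. measure lborel K *\<^sub>R g x) - (F d - F c) = sum D p"
        using additive_tagged_division_1[OF \<open>c \<le> d\<close> p, of F]
        by (simp add: D_def split_def sum_subtractf)
      also have "\<dots> = sum D p1 + sum D p2"
        using sp by (simp add: sum.union_disjoint)
      also have "norm \<dots> \<le> (\<Sum>z\<in>p1. norm (D z)) + (\<Sum>z\<in>p2. norm (D z))"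
        by (rule order_trans[OF norm_triangle_ineq add_mono[OF norm_sum norm_sum]])
      also have "(\<Sum>z\<in>p1. norm (D z)) < \<epsilon> / 2"
      proof -
        have part: "p1 tagged_partial_division_of {c..d}"
          using p unfolding p1_def tagged_division_of_def
          by (auto intro: tagged_partial_division_subset)
        note self = tagged_partial_division_of_Union_self[OF part]
        let ?\<D> = "snd ` p1"
        have div: "?\<D> division_of \<Union>?\<D>" using self by (rule division_of_tagged_division)
        have sub: "\<Union>?\<D> \<subseteq> {c..d}" using Kuv sp(1) by force
        have subU: "\<Union>?\<D> \<subseteq> U"
          using fineD[OF fine] sp(1) unfolding p1_def \<gamma>_def by force
        have "(\<Sum>z\<in>p1. norm (D z)) = (\<Sum>(x,K)\<in>p1. norm (F (Sup K) - F (Inf K)))"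
          by (intro sum.cong) (auto simp: D_def p1_def g_def norm_minus_commute)
        also have "\<dots> = (\<Sum>(x,K)\<in>p1. if K = {} then 0 else norm (F (Sup K) - F (Inf K)))"
          using Kuv sp(1) by (intro sum.cong) fastforce+
        also have "\<dots> = (\<Sum>K\<in>?\<D>. if K = {} then 0 else norm (F (Sup K) - F (Inf K)))"
        proof (rule sum.over_tagged_division_lemma[OF self])
          fix u v :: real assume "box u v = {}"
          then have "cbox u v = {} \<or> cbox u v = {u}" by (cases "u = v") auto
          then show "(if cbox u v = {} then 0
              else norm (F (Sup (cbox u v)) - F (Inf (cbox u v)))) = 0"
            by auto
        qed
        also have "\<dots> = (\<Sum>K\<in>?\<D>. norm (F (Sup K) - F (Inf K)))"
          using Kuv sp(1) by (intro sum.cong) fastforce+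
        also have "\<dots> < \<epsilon> / 2"
        proof (rule \<delta>(2)[OF div sub])
          have "(\<Sum>K\<in>?\<D>. Sup K - Inf K) = (\<Sum>K\<in>?\<D>. measure lebesgue K)"
          proof (rule sum.cong[OF refl])
            fix K assume "K \<in> ?\<D>"
            then obtain x where "(x,K) \<in> p" by (auto simp: p1_def)
            with Kuv show "Sup K - Inf K = measure lebesgue K" by fastforce
          qed
          also have "\<dots> = measure lebesgue (\<Union>?\<D>)"
            using content_division[OF div] by simp
          also have "\<dots> \<le> measure lebesgue U"
            using subU Um div by (intro measure_mono_fmeasurable) (auto intro: lmeasurable_division[OF div] fmeasurableD)
          finally show "(\<Sum>K\<in>?\<D>. Sup K - Inf K) < \<delta>" using Ulm by simp
        qed
        finally show ?thesis .
      qed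
      also have "(\<Sum>z\<in>p2. norm (D z)) \<le> e * (d - c)"
      proof -
        have "(\<Sum>z\<in>p2. norm (D z)) \<le> (\<Sum>(x,K)\<in>p2. e * (Sup K - Inf K))"
        proof (rule sum_mono, clarify)
          fix x K assume xK: "(x, K) \<in> p2"
          then have "(x,K) \<in> p" "x \<notin> N" by (auto simp: p2_def)
          then obtain u v where uv: "u \<le> v" "K = {u..v}" "x \<in> K" "K \<subseteq> {c..d}" using Kuv by blast
          have K: "K \<subseteq> ball x (r x)"
            using fineD[OF fine \<open>(x,K) \<in> p\<close>] \<open>x \<notin> N\<close> by (simp add: \<gamma>_def)
          have x: "x \<in> {c..d} - N" using uv \<open>x \<notin> N\<close> by auto
          have bd: "norm (F y - F x - (y - x) *\<^sub>R f x) \<le> e * norm (y - x)" if "y \<in> K" for y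
            using r(2)[OF x, of y] that K uv by (auto simp: dist_real_def abs_minus_commute subset_iff)
          have "norm ((v - u) *\<^sub>R f x - (F v - F u))
              = norm ((F u - F x - (u - x) *\<^sub>R f x) - (F v - F x - (v - x) *\<^sub>R f x))"
            by (auto simp: algebra_simps)
          also have "\<dots> \<le> e * norm (u - x) + e * norm (v - x)"
            by (rule order_trans[OF norm_triangle_ineq4 add_mono[OF bd bd]]) (use uv in auto)
          also have "\<dots> = e * (v - u)" using uv by (auto simp: algebra_simps)
          finally show "norm (D (x, K)) \<le> e * (Sup K - Inf K)"
            using uv x by (simp add: D_def g_def)
        qed
        also have "\<dots> \<le> (\<Sum>(x,K)\<in>p. e * (Sup K - Inf K))"
        proof (rule sum_mono2[OF finp])
          show "p2 \<subseteq> p" using sp(1) by blast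
          fix z assume "z \<in> p - p2"
          then obtain x K where "z = (x, K)" "(x, K) \<in> p" by (cases z) auto
          moreover obtain u v where "u \<le> v" "K = {u..v}" using Kuv \<open>(x, K) \<in> p\<close> by blast
          ultimately show "0 \<le> (case z of (x, K) \<Rightarrow> e * (Sup K - Inf K))" using e by simp
        qed
        also have "\<dots> = e * (d - c)"
          using additive_tagged_division_1[OF \<open>c \<le> d\<close> p, of "\<lambda>x. x"]
          by (simp add: split_def flip: sum_distrib_left)
        finally show ?thesis .
      qed
      finally show ?thesis using e(2) by linarith
    qed
    ultimately have "gauge \<gamma> \<and> (\<forall>p. p tagged_division_of {c..d} \<and> \<gamma> fine p \<longrightarrow>
        norm ((\<Sum>(x, K)\<in>p. measure lborel K *\<^sub>R g x) - (F d - F c)) < \<epsilon>)"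
      by simp
    then show "\<exists>\<gamma>. gauge \<gamma> \<and> (\<forall>p. p tagged_division_of {c..d} \<and> \<gamma> fine p \<longrightarrow>
        norm ((\<Sum>(x, K)\<in>p. measure lborel K *\<^sub>R g x) - (F d - F c)) < \<epsilon>)"
      by (rule exI[of _ \<gamma>])
  qed
  show ?thesis
    by (rule has_integral_spike[OF N _ *]) (simp add: g_def)
qed

section \<open>Linear initial value problems on a half-line\<close>

lemma continuous_on_half_lineI:
  fixes f :: "real \<Rightarrow> 'a::topological_space"
  assumes "\<And>b. continuous_on {a..b} f"
  shows "continuous_on {a..} f"
  unfolding continuous_on_eq_continuous_within
proof
  fix x assume "x \<in> {a..}"
  then have "continuous (at x within {a..x+1}) f"
    using assms[of "x+1"] by (simp add: continuous_on_eq_continuous_within)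
  moreover have "at x within {a..x+1} = at x within {a..}"
    by (rule at_within_nhd[of _ "{..<x+1}"]) auto
  ultimately show "continuous (at x within {a..}) f" by simp
qed

lemma continuous_on_half_line_extend:
  fixes f :: "real \<Rightarrow> 'a::topological_space"
  assumes "continuous_on {a<..} f" "(f \<longlongrightarrow> f a) (at_right a)"
  shows "continuous_on {a..} f"
  unfolding continuous_on_def
proof
  fix x assume "x \<in> {a..}"
  then consider "x = a" | "x > a" by fastforce
  then show "(f \<longlongrightarrow> f x) (at x within {a..})"
  proof cases
    case 1
    then show ?thesis using assms(2) by (simp add: at_within_Ici_at_right)
  next
    case 2
    have "at x within {a<..} = at x within {a..}"
      by (rule at_within_nhd[of _ "{a<..}"]) (use 2 in auto)
    moreover have "(f \<longlongrightarrow> f x) (at x within {a<..})"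
      using assms(1) 2 unfolding continuous_on_def by blast
    ultimately show ?thesis by (simp only:)
  qed
qed

text \<open>
  The solution is a fixed point of the Volterra operator \<open>y \<mapsto> y0 + \<integral> A y\<close>. Dividing \<open>y\<close> by the
  weight \<open>w x = exp (2 \<integral> k)\<close> makes this operator a contraction with constant \<open>1/2\<close> on all
  bounded continuous functions at once, because \<open>\<integral> w k = (w - 1) / 2\<close>; so no continuation from
  short intervals is required.
\<close>

lemma linear_volterra_ivp:
  fixes A :: "real \<Rightarrow> 'a::banach \<Rightarrow> 'a" and k :: "real \<Rightarrow> real"
  assumes k: "continuous_on {0..} k" and k0: "\<And>s. s \<ge> 0 \<Longrightarrow> k s \<ge> 0"
    and bound: "\<And>s y. s \<ge> 0 \<Longrightarrow> norm (A s y) \<le> k s * norm y"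
    and lin: "\<And>s. s \<ge> 0 \<Longrightarrow> linear (A s)"
    and cont: "\<And>y. continuous_on {0..} y \<Longrightarrow> continuous_on {0..} (\<lambda>s. A s (y s))"
  obtains y where "continuous_on {0..} y" "y 0 = y0"
    "\<And>x. x > 0 \<Longrightarrow> (y has_vector_derivative A x (y x)) (at x)"
proof -
  define w where "w x = exp (2 * integral {0..x} k)" for x
  have kint: "k integrable_on {0..x}" for x
    by (intro integrable_continuous_real continuous_on_subset[OF k]) auto
  have dw: "(w has_real_derivative 2 * w x * k x) (at x within {0..b})" if "x \<in> {0..b}" for x b
  proof -
    have "((\<lambda>x. integral {0..x} k) has_real_derivative k x) (at x within {0..b})"
      by (rule integral_has_real_derivative[OF continuous_on_subset[OF k] that]) auto
    then show ?thesis
      unfolding w_def by (auto intro!: derivative_eq_intros)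
  qed
  have w_pos: "w x > 0" for x by (simp add: w_def)
  have norm_divide_w: "norm (v /\<^sub>R w x) \<le> C" if "norm v \<le> C * w x" for v :: 'a and x C
  proof -
    have "norm (v /\<^sub>R w x) = norm v / w x"
      using w_pos[of x] by (simp add: divide_inverse mult.commute)
    then show ?thesis using that w_pos[of x] by (simp add: pos_divide_le_eq)
  qed
  have w_cont: "continuous_on {0..b} w" for b
    by (rule DERIV_continuous_on[OF dw])
  have w_int: "((\<lambda>s. w s * k s) has_integral (w x - 1) / 2) {0..x}" if "x \<ge> 0" for x
  proof -
    have "((\<lambda>s. 2 * w s * k s) has_integral (w x - w 0)) {0..x}"
      using that dw
      by (intro fundamental_theorem_of_calculus)
         (auto simp: has_real_derivative_iff_has_vector_derivative)
    from has_integral_mult_right[OF this, of "1/2"] show ?thesis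
      by (simp add: w_def)
  qed
  define I where "I g x = integral {0..x} (\<lambda>s. w s *\<^sub>R A s (g s))" for g :: "real \<Rightarrow> 'a" and x
  have integrand_cont: "continuous_on {0..b} (\<lambda>s. w s *\<^sub>R A s (g s))"
    if "continuous_on {0..} g" for g b
    using that by (intro continuous_intros w_cont continuous_on_subset[OF cont]) auto
  have I_bound: "norm (I g x) \<le> B / 2 * w x"
    if g: "continuous_on {0..} g" "\<And>s. s \<ge> 0 \<Longrightarrow> norm (g s) \<le> B" and x: "x \<ge> 0" for g x B
  proof -
    have "B \<ge> 0" using g(2)[of 0] norm_ge_zero order_trans by blast
    have "norm (I g x) \<le> integral {0..x} (\<lambda>s. B * (w s * k s))"
      unfolding I_def
    proof (rule integral_norm_bound_integral)
      show "(\<lambda>s. B * (w s * k s)) integrable_on {0..x}"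
        using w_int[OF x] by (intro integrable_on_mult_right) blast
      fix s assume s: "s \<in> {0..x}"
      have "norm (w s *\<^sub>R A s (g s)) = w s * norm (A s (g s))" using w_pos[of s] by simp
      also have "\<dots> \<le> w s * (k s * norm (g s))"
        using bound w_pos[of s] s by (intro mult_left_mono) auto
      also have "\<dots> \<le> w s * (k s * B)"
        using g(2) w_pos[of s] k0 s by (intro mult_left_mono) auto
      finally show "norm (w s *\<^sub>R A s (g s)) \<le> B * (w s * k s)" by (simp add: ac_simps)
    qed (use integrand_cont[OF g(1)] in \<open>auto intro: integrable_continuous_real\<close>)
    also have "\<dots> = B * ((w x - 1) / 2)"
      using w_int[OF x] by (simp add: integral_unique)
    also have "\<dots> \<le> B / 2 * w x" using \<open>B \<ge> 0\<close> by (simp add: algebra_simps)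
    finally show ?thesis .
  qed
  have I_cont: "continuous_on {0..} (I g)" if "continuous_on {0..} g" for g
  proof -
    have "continuous_on {0..b} (I g)" for b
      unfolding I_def
      by (intro indefinite_integral_continuous_1 integrable_continuous_real integrand_cont that)
    then show ?thesis by (rule continuous_on_half_lineI)
  qed
  have w_cont': "continuous_on {0..} w"
    by (rule continuous_on_half_lineI[OF w_cont])
  \<comment> \<open>Bounded continuous functions are indexed by the whole line, hence the truncation \<open>max 0 x\<close>.\<close>
  define \<Phi> where "\<Phi> g = Bcontfun (\<lambda>x. (y0 + I g (max 0 x)) /\<^sub>R w (max 0 x))" for g :: "real \<Rightarrow>\<^sub>C 'a"
  have w_ge1: "w x \<ge> 1" if "x \<ge> 0" for x
  proof -
    have "0 \<le> integral {0..x} k" by (rule integral_nonneg[OF kint]) (use k0 in auto)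
    then show ?thesis by (simp add: w_def)
  qed
  have \<Phi>: "\<Phi> g x = (y0 + I g (max 0 x)) /\<^sub>R w (max 0 x)" for g x
  proof -
    have "(\<lambda>x. (y0 + I g (max 0 x)) /\<^sub>R w (max 0 x)) \<in> bcontfun"
    proof (rule bcontfun_normI)
      have "continuous_on {0..} (\<lambda>x. (y0 + I g x) /\<^sub>R w x)"
        by (intro continuous_intros I_cont w_cont') (auto simp: w_def)
      then show "continuous_on UNIV (\<lambda>x. (y0 + I g (max 0 x)) /\<^sub>R w (max 0 x))"
        by (rule continuous_on_compose2) (auto intro!: continuous_intros)
      fix x :: real
      have "norm (y0 + I g (max 0 x)) \<le> norm y0 + norm g / 2 * w (max 0 x)"
        using I_bound[of g "norm g" "max 0 x"] by (intro norm_triangle_le add_left_mono) (auto intro: norm_bounded)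
      also have "\<dots> \<le> (norm y0 + norm g / 2) * w (max 0 x)"
        using mult_left_mono[OF w_ge1[of "max 0 x"], of "norm y0"] by (simp add: algebra_simps)
      finally show "norm ((y0 + I g (max 0 x)) /\<^sub>R w (max 0 x)) \<le> norm y0 + norm g / 2"
        by (rule norm_divide_w)
    qed
    then show ?thesis by (simp add: \<Phi>_def Bcontfun_inverse)
  qed
  have "\<exists>!g. \<Phi> g = g"
  proof (rule banach_fix_type)
    show "\<forall>g g'. dist (\<Phi> g) (\<Phi> g') \<le> 1/2 * dist g g'"
    proof (intro allI dist_bound)
      fix g g' :: "real \<Rightarrow>\<^sub>C 'a" and x :: real
      let ?x = "max 0 x"
      have "I g ?x - I g' ?x = I (\<lambda>s. g s - g' s) ?x"
        unfolding I_def
        by (subst integral_diff[symmetric])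
           (auto intro!: integrable_continuous_real integrand_cont integral_cong simp: lin linear_diff scaleR_diff_right)
      then have "norm (I g ?x - I g' ?x) \<le> dist g g' / 2 * w ?x"
        using I_bound[of "\<lambda>s. g s - g' s" "dist g g'" ?x]
        by (auto intro!: continuous_intros simp flip: dist_norm intro: dist_bounded)
      then have "norm ((I g ?x - I g' ?x) /\<^sub>R w ?x) \<le> 1/2 * dist g g'"
        by (intro norm_divide_w) simp
      then show "dist (\<Phi> g x) (\<Phi> g' x) \<le> 1/2 * dist g g'"
        by (simp add: \<Phi> dist_norm algebra_simps)
    qed
  qed auto
  then obtain g where g: "\<Phi> g = g" by blast
  define y where "y x = y0 + I g x" for x
  have y: "y x = w x *\<^sub>R g x" if "x \<ge> 0" for x
    using \<Phi>[of g x] w_pos[of x] that by (simp add: g y_def)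
  show ?thesis
  proof
    show "continuous_on {0..} y" unfolding y_def by (intro continuous_intros I_cont) auto
    show "y 0 = y0" by (simp add: y_def I_def)
    fix x :: real assume "x > 0"
    have "((\<lambda>x. y0 + I g x) has_vector_derivative 0 + w x *\<^sub>R A x (g x)) (at x within {0..x+1})"
      unfolding I_def
      using \<open>x > 0\<close> integrand_cont[of g "x+1"]
      by (intro has_vector_derivative_add has_vector_derivative_const integral_has_vector_derivative) auto
    moreover have "w x *\<^sub>R A x (g x) = A x (y x)"
      using \<open>x > 0\<close> lin[of x] by (simp add: y linear_cmul)
    moreover have "at x within {0..x+1} = at x"
      using \<open>x > 0\<close> by (intro at_within_interior) auto
    ultimately show "(y has_vector_derivative A x (y x)) (at x)"
      unfolding y_def[abs_def] by simp
  qed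
qed

section \<open>The equation as a first-order system\<close>

text \<open>
  With the quasi-derivative \<open>v = p u'\<close> the equation \<open>-(p u')' - q u = z u\<close> is the system
  \<open>u' = v / p\<close>, \<open>v' = -(q + z) u\<close>, whose coefficients are continuous up to the endpoint \<open>0\<close>.
\<close>

locale sturm_liouville =
  fixes p q :: "real \<Rightarrow> real"
  assumes p_C1: "p C1_differentiable_on {0<..}"
    and q_cont: "continuous_on {0<..} q"
    and p_lim: "(p \<longlongrightarrow> p 0) (at_right 0)"
    and q_lim: "(q \<longlongrightarrow> q 0) (at_right 0)"
    and p_pos: "\<forall>x\<ge>0. p x > 0"
begin

text \<open>
  A version of \<^const>\<open>solution\<close> that ignores the values at \<open>x \<le> 0\<close> and is therefore stable under
  linear combinations and conjugation.
\<close>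

definition system :: "complex \<Rightarrow> (real \<Rightarrow> complex) \<Rightarrow> (real \<Rightarrow> complex) \<Rightarrow> bool" where
  "system z u v \<longleftrightarrow> (\<forall>x>0. (u has_vector_derivative v x / of_real (p x)) (at x) \<and>
     (v has_vector_derivative - (of_real (q x) + z) * u x) (at x))"

definition quasi_deriv :: "(real \<Rightarrow> complex) \<Rightarrow> real \<Rightarrow> complex" where
  "quasi_deriv u x = of_real (p x) * vector_derivative u (at x)"

lemma p_nonzero: "x \<ge> 0 \<Longrightarrow> p x \<noteq> 0"
  using p_pos by (metis less_irrefl)

lemma p_continuous: "continuous_on {0..} p"
  using p_C1 p_lim by (intro continuous_on_half_line_extend C1_differentiable_imp_continuous_on)

lemma q_continuous: "continuous_on {0..} q"
  using q_cont q_lim by (rule continuous_on_half_line_extend)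

lemma solution_system: "solution p q z u \<Longrightarrow> system z u (quasi_deriv u)"
  unfolding system_def solution_def
proof (intro allI impI conjI)
  fix x :: real
  assume *: "u \<in> extensional {0<..} \<and> (\<forall>x>0. u differentiable at x \<and>
        (\<lambda>y. of_real (p y) * vector_derivative u (at y)) differentiable at x \<and>
        - vector_derivative (\<lambda>y. of_real (p y) * vector_derivative u (at y)) (at x)
          - of_real (q x) * u x = z * u x)" and x: "x > 0"
  then show "(u has_vector_derivative quasi_deriv u x / of_real (p x)) (at x)"
    using p_nonzero[of x] by (simp add: quasi_deriv_def vector_derivative_works)
  have "- (of_real (q x) + z) * u x = vector_derivative (quasi_deriv u) (at x)"
  proof -
    have "- vector_derivative (quasi_deriv u) (at x) - of_real (q x) * u x = z * u x"
      using * x unfolding quasi_deriv_def[abs_def] by blast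
    then have "- (of_real (q x) * u x) - z * u x = vector_derivative (quasi_deriv u) (at x)"
      by (simp flip: \<open>_ = z * u x\<close>)
    moreover have "- (of_real (q x) + z) * u x = - (of_real (q x) * u x) - z * u x"
      by (simp add: algebra_simps)
    ultimately show ?thesis by simp
  qed
  then show "(quasi_deriv u has_vector_derivative - (of_real (q x) + z) * u x) (at x)"
    using * x unfolding quasi_deriv_def[abs_def] by (simp add: vector_derivative_works)
qed

lemma system_cong:
  assumes "system z u v" "\<And>x. x > 0 \<Longrightarrow> u' x = u x" "\<And>x. x > 0 \<Longrightarrow> v' x = v x"
  shows "system z u' v'"
  unfolding system_def
proof (intro allI impI conjI)
  fix x :: real assume x: "x > 0"
  show "(u' has_vector_derivative v' x / of_real (p x)) (at x)"
    by (rule has_vector_derivative_transform_within_open[of u _ _ "{0<..}"])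
       (use assms x in \<open>auto simp: system_def\<close>)
  show "(v' has_vector_derivative - (of_real (q x) + z) * u' x) (at x)"
    by (rule has_vector_derivative_transform_within_open[of v _ _ "{0<..}"])
       (use assms x in \<open>auto simp: system_def\<close>)
qed

lemma system_quasi_deriv: "system z u v \<Longrightarrow> x > 0 \<Longrightarrow> quasi_deriv u x = v x"
  using p_nonzero[of x] by (auto simp: system_def quasi_deriv_def vector_derivative_at)

lemma vector_derivative_quasi:
  "x > 0 \<Longrightarrow> vector_derivative u (at x) = quasi_deriv u x / of_real (p x)"
  using p_nonzero[of x] by (simp add: quasi_deriv_def)

lemma system_solution:
  assumes "system z u v"
  shows "solution p q z (restrict u {0<..})"
proof -
  let ?u = "restrict u {0<..}"
  have s: "system z ?u v" using assms by (rule system_cong) auto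
  then have s': "system z ?u (quasi_deriv ?u)"
    by (rule system_cong) (auto simp: system_quasi_deriv[OF s])
  show ?thesis
    unfolding solution_def
  proof (intro conjI allI impI)
    fix x :: real assume x: "x > 0"
    note d = s'[unfolded system_def quasi_deriv_def[abs_def], rule_format, OF x]
    from d show "?u differentiable at x" "(\<lambda>y. of_real (p y) * vector_derivative ?u (at y)) differentiable at x"
      by (auto intro: differentiableI_vector)
    from d have D: "vector_derivative (\<lambda>y. of_real (p y) * vector_derivative ?u (at y)) (at x)
        = - (of_real (q x) + z) * ?u x"
      by (intro vector_derivative_at) blast
    show "- vector_derivative (\<lambda>y. of_real (p y) * vector_derivative ?u (at y)) (at x)
          - of_real (q x) * ?u x = z * ?u x"
      unfolding D by (simp add: algebra_simps)
  qed simp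
qed

lemma system_lincomb:
  assumes "system z u1 v1" "system z u2 v2"
  shows "system z (\<lambda>x. c * u1 x + d * u2 x) (\<lambda>x. c * v1 x + d * v2 x)"
  unfolding system_def
proof (intro allI impI conjI)
  fix x :: real assume x: "x > 0"
  have 1: "(u1 has_vector_derivative v1 x / of_real (p x)) (at x)"
      "(v1 has_vector_derivative - (of_real (q x) + z) * u1 x) (at x)"
      "(u2 has_vector_derivative v2 x / of_real (p x)) (at x)"
      "(v2 has_vector_derivative - (of_real (q x) + z) * u2 x) (at x)"
    using assms x by (auto simp: system_def)
  show "((\<lambda>x. c * u1 x + d * u2 x) has_vector_derivative
      (c * v1 x + d * v2 x) / of_real (p x)) (at x)"
    by (auto intro!: derivative_eq_intros 1 simp: add_divide_distrib)
  show "((\<lambda>x. c * v1 x + d * v2 x) has_vector_derivative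
      - (of_real (q x) + z) * (c * u1 x + d * u2 x)) (at x)"
    by (auto intro!: derivative_eq_intros 1 simp: algebra_simps)
qed

lemma system_cnj:
  assumes "system (cnj z) u v"
  shows "system z (\<lambda>x. cnj (u x)) (\<lambda>x. cnj (v x))"
  unfolding system_def
proof (intro allI impI conjI)
  fix x :: real assume x: "x > 0"
  then have "(u has_vector_derivative v x / of_real (p x)) (at x)"
      "(v has_vector_derivative - (of_real (q x) + cnj z) * u x) (at x)"
    using assms by (auto simp: system_def)
  from this[THEN has_vector_derivative_cnj]
  show "((\<lambda>x. cnj (u x)) has_vector_derivative cnj (v x) / of_real (p x)) (at x)"
      "((\<lambda>x. cnj (v x)) has_vector_derivative - (of_real (q x) + z) * cnj (u x)) (at x)"
    by (simp_all add: algebra_simps)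
qed

definition wronskian ::
    "(real \<Rightarrow> complex) \<Rightarrow> (real \<Rightarrow> complex) \<Rightarrow> (real \<Rightarrow> complex) \<Rightarrow> (real \<Rightarrow> complex) \<Rightarrow> real \<Rightarrow> complex"
  where "wronskian u1 v1 u2 v2 x = u1 x * v2 x - u2 x * v1 x"

lemma wronskian_constant:
  assumes "system z u1 v1" "system z u2 v2"
  obtains w where "\<And>x. x > 0 \<Longrightarrow> wronskian u1 v1 u2 v2 x = w"
proof -
  have "(wronskian u1 v1 u2 v2 has_vector_derivative 0) (at x within {0<..})" if "x \<in> {0<..}" for x
  proof -
    have 1: "(u1 has_vector_derivative v1 x / of_real (p x)) (at x)"
      "(v1 has_vector_derivative - (of_real (q x) + z) * u1 x) (at x)"
      "(u2 has_vector_derivative v2 x / of_real (p x)) (at x)"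
      "(v2 has_vector_derivative - (of_real (q x) + z) * u2 x) (at x)"
      using assms that by (auto simp: system_def)
    have "(wronskian u1 v1 u2 v2 has_vector_derivative 0) (at x)"
      unfolding wronskian_def[abs_def]
      by (auto intro!: derivative_eq_intros 1 simp: algebra_simps)
    then show ?thesis by (rule has_vector_derivative_at_within)
  qed
  from has_vector_derivative_zero_constant[OF _ this] show ?thesis
    using that by auto
qed

text \<open>
  A constant Wronskian can be computed from its limit at either end of the half-line.
\<close>

lemma wronskian_eq_limit:
  assumes "system z u1 v1" "system z u2 v2" "(wronskian u1 v1 u2 v2 \<longlongrightarrow> w) F"
    "F \<noteq> bot" "\<forall>\<^sub>F x in F. x > 0" "x > 0"
  shows "wronskian u1 v1 u2 v2 x = w"
proof -
  obtain w' where w': "\<And>x. x > 0 \<Longrightarrow> wronskian u1 v1 u2 v2 x = w'"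
    using wronskian_constant[OF assms(1,2)] by blast
  have "(wronskian u1 v1 u2 v2 \<longlongrightarrow> w') F"
    by (rule tendsto_eventually) (use assms(5) in eventually_elim, simp add: w')
  then show ?thesis using assms(3,4,6) w' tendsto_unique by blast
qed

text \<open>
  Cramer's rule with constant determinants; the case \<open>w1 = w2 = 0\<close> shows that a solution whose
  Wronskians with a fundamental system vanish is zero.
\<close>

lemma fundamental_system_expansion:
  assumes "\<And>x. x > 0 \<Longrightarrow> wronskian u1 v1 u2 v2 x = w" "w \<noteq> 0"
    "\<And>x. x > 0 \<Longrightarrow> wronskian u v u2 v2 x = w1" "\<And>x. x > 0 \<Longrightarrow> wronskian u1 v1 u v x = w2" "x > 0"
  shows "u x = w1 / w * u1 x + w2 / w * u2 x"
proof -
  have "w * u x = w1 * u1 x + w2 * u2 x"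
    unfolding assms(1)[OF assms(5), symmetric] assms(3)[OF assms(5), symmetric]
      assms(4)[OF assms(5), symmetric] wronskian_def by (simp add: algebra_simps)
  then show ?thesis using assms(2) by (simp add: field_simps)
qed

section \<open>The initial value problem at the left endpoint\<close>

lemma system_ivp:
  obtains u v where "system z u v" "(u \<longlongrightarrow> c) (at_right 0)" "(v \<longlongrightarrow> d) (at_right 0)"
proof -
  define A where "A s y = (snd y / of_real (p s), - (of_real (q s) + z) * fst y)"
    for s and y :: "complex \<times> complex"
  have lin: "linear (A s)" for s
    by (rule linearI) (auto simp: A_def algebra_simps add_divide_distrib scaleR_conv_of_real)
  obtain y where y: "continuous_on {0..} y" "y 0 = (c, d)"
    "\<And>x. x > 0 \<Longrightarrow> (y has_vector_derivative A x (y x)) (at x)"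
  proof (rule linear_volterra_ivp[of "\<lambda>s. 1 / p s + (\<bar>q s\<bar> + norm z)" A "(c, d)"])
    show "continuous_on {0..} (\<lambda>s. 1 / p s + (\<bar>q s\<bar> + norm z))"
      using p_nonzero by (intro continuous_intros p_continuous q_continuous) auto
    show "1 / p s + (\<bar>q s\<bar> + norm z) \<ge> 0" if "s \<ge> 0" for s
      using p_pos that by (intro add_nonneg_nonneg divide_nonneg_nonneg) (auto simp: less_imp_le)
    show "norm (A s y) \<le> (1 / p s + (\<bar>q s\<bar> + norm z)) * norm y" if "s \<ge> 0" for s y
    proof -
      have "norm (A s y) \<le> norm (snd y / of_real (p s)) + norm ((of_real (q s) + z) * fst y)"
        unfolding A_def by (rule order_trans[OF norm_Pair_le]) (simp only: minus_mult_left[symmetric] norm_minus_cancel order_refl)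
      also have "\<dots> \<le> 1 / p s * norm y + (\<bar>q s\<bar> + norm z) * norm y"
      proof (rule add_mono)
        show "norm (snd y / of_real (p s)) \<le> 1 / p s * norm y"
        proof -
          have "p s > 0" using p_pos that by blast
          moreover have "norm (snd y) \<le> norm y" using norm_snd_le[of "snd y" "fst y"] by simp
          ultimately show ?thesis by (simp add: norm_divide divide_right_mono)
        qed
        show "norm ((of_real (q s) + z) * fst y) \<le> (\<bar>q s\<bar> + norm z) * norm y"
          unfolding norm_mult
          using norm_fst_le[of "fst y" "snd y"] by (intro mult_mono norm_triangle_le) auto
      qed
      finally show ?thesis by (simp add: algebra_simps)
    qed
    show "linear (A s)" for s by (rule lin)
    show "continuous_on {0..} (\<lambda>s. A s (y s))" if "continuous_on {0..} y" for y
      unfolding A_def using p_nonzero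
      by (intro continuous_intros p_continuous q_continuous that) auto
  qed blast
  show ?thesis
  proof
    show "system z (\<lambda>x. fst (y x)) (\<lambda>x. snd (y x))"
      unfolding system_def
    proof (intro allI impI)
      fix x :: real assume "x > 0"
      from y(3)[OF this]
      have "((\<lambda>x. fst (y x)) has_vector_derivative fst (A x (y x))) (at x)"
        "((\<lambda>x. snd (y x)) has_vector_derivative snd (A x (y x))) (at x)"
        by (auto intro: bounded_linear.has_vector_derivative bounded_linear_fst bounded_linear_snd)
      then show "((\<lambda>x. fst (y x)) has_vector_derivative snd (y x) / of_real (p x)) (at x) \<and>
        ((\<lambda>x. snd (y x)) has_vector_derivative - (of_real (q x) + z) * fst (y x)) (at x)"
        by (simp add: A_def)
    qed
    have "(y \<longlongrightarrow> (c, d)) (at_right 0)"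
      using bspec[OF y(1)[unfolded continuous_on_def], of 0] y(2)
      by (simp add: at_within_Ici_at_right)
    from tendsto_fst[OF this] tendsto_snd[OF this]
    show "((\<lambda>x. fst (y x)) \<longlongrightarrow> c) (at_right 0)" "((\<lambda>x. snd (y x)) \<longlongrightarrow> d) (at_right 0)"
      by simp_all
  qed
qed

lemma fundamental_system:
  obtains u1 v1 u2 v2 where "system z u1 v1" "(u1 \<longlongrightarrow> 1) (at_right 0)" "(v1 \<longlongrightarrow> 0) (at_right 0)"
    "system z u2 v2" "(u2 \<longlongrightarrow> 0) (at_right 0)" "(v2 \<longlongrightarrow> 1) (at_right 0)"
    "\<And>x. x > 0 \<Longrightarrow> wronskian u1 v1 u2 v2 x = 1"
proof -
  obtain u1 v1 where 1: "system z u1 v1" "(u1 \<longlongrightarrow> 1) (at_right 0)" "(v1 \<longlongrightarrow> 0) (at_right 0)"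
    using system_ivp by blast
  obtain u2 v2 where 2: "system z u2 v2" "(u2 \<longlongrightarrow> 0) (at_right 0)" "(v2 \<longlongrightarrow> 1) (at_right 0)"
    using system_ivp by blast
  have W: "wronskian u1 v1 u2 v2 x = 1" if "x > 0" for x
    using tendsto_diff[OF tendsto_mult[OF 1(2) 2(3)] tendsto_mult[OF 2(2) 1(3)]]
      eventually_at_right_less that
    by (intro wronskian_eq_limit[OF 1(1) 2(1)]) (auto simp: wronskian_def[abs_def])
  with 1 2 show ?thesis by (rule that)
qed

text \<open>
  Since \<open>p\<close> has the positive limit \<open>p 0\<close> at \<open>0\<close>, prescribing the limit of \<open>u'\<close> amounts to
  prescribing the limit of \<open>p u'\<close>.
\<close>

lemma initial_values_iff:
  assumes "system z u v"
  shows "initial_values u c d \<longleftrightarrow> (u \<longlongrightarrow> c) (at_right 0) \<and> (v \<longlongrightarrow> of_real (p 0) * d) (at_right 0)"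
proof -
  have p: "((\<lambda>x. complex_of_real (p x)) \<longlongrightarrow> of_real (p 0)) (at_right 0)"
    by (intro tendsto_of_real p_lim)
  have p0: "complex_of_real (p 0) \<noteq> 0" using p_nonzero by simp
  have ev: "\<forall>\<^sub>F x in at_right 0. v x = of_real (p x) * vector_derivative u (at x)"
    using eventually_at_right_less[of 0]
    by eventually_elim (use system_quasi_deriv[OF assms] in \<open>simp add: quasi_deriv_def\<close>)
  have ev': "\<forall>\<^sub>F x in at_right 0. v x / of_real (p x) = vector_derivative u (at x)"
    using ev eventually_at_right_less[of 0] by eventually_elim (simp add: p_nonzero)
  show ?thesis
    unfolding initial_values_def
  proof (intro conj_cong refl iffI)
    assume "((\<lambda>x. vector_derivative u (at x)) \<longlongrightarrow> d) (at_right 0)"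
    from tendsto_mult[OF p this] show "(v \<longlongrightarrow> of_real (p 0) * d) (at_right 0)"
      by (simp add: tendsto_cong[OF ev])
  next
    assume "(v \<longlongrightarrow> of_real (p 0) * d) (at_right 0)"
    from tendsto_divide[OF this p p0] show "((\<lambda>x. vector_derivative u (at x)) \<longlongrightarrow> d) (at_right 0)"
      using p0 by (simp add: tendsto_cong[OF ev'])
  qed
qed

text \<open>
  Uniqueness: the difference of two solutions and its quasi-derivative tend to \<open>0\<close> at the left
  endpoint, hence so do the Wronskians with a fundamental system, which are therefore zero.
\<close>

lemma initial_value_solution_unique:
  "\<exists>!u. solution p q z u \<and> initial_values u c d"
proof -
  obtain u v where uv: "system z u v" "(u \<longlongrightarrow> c) (at_right 0)" "(v \<longlongrightarrow> of_real (p 0) * d) (at_right 0)"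
    using system_ivp[of z c "of_real (p 0) * d"] by blast
  let ?u = "restrict u {0<..}"
  have "system z ?u v" using uv(1) by (rule system_cong) auto
  moreover have "(?u \<longlongrightarrow> c) (at_right 0)"
    by (rule tendsto_cong[THEN iffD1, OF _ uv(2)])
       (use eventually_at_right_less[of 0] in eventually_elim, simp)
  ultimately have ex: "solution p q z ?u \<and> initial_values ?u c d"
    using uv system_solution by (simp add: initial_values_iff)
  show ?thesis
  proof (rule ex1I, rule ex)
    fix u' assume u': "solution p q z u' \<and> initial_values u' c d"
    define v' where "v' = quasi_deriv u'"
    have s': "system z u' v'" unfolding v'_def by (rule solution_system) (use u' in blast)
    with u' have lim': "(u' \<longlongrightarrow> c) (at_right 0)" "(v' \<longlongrightarrow> of_real (p 0) * d) (at_right 0)"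
      by (auto simp: initial_values_iff)
    define y where "y x = 1 * u' x + (-1) * u x" for x
    define w where "w x = 1 * v' x + (-1) * v x" for x
    have yw: "system z y w" unfolding y_def w_def by (rule system_lincomb[OF s' uv(1)])
    have lim0: "(y \<longlongrightarrow> 0) (at_right 0)" "(w \<longlongrightarrow> 0) (at_right 0)"
      using tendsto_diff[OF lim'(1) uv(2)] tendsto_diff[OF lim'(2) uv(3)]
      by (simp_all add: y_def[abs_def] w_def[abs_def])
    obtain u1 v1 u2 v2 where 1: "system z u1 v1" "(u1 \<longlongrightarrow> 1) (at_right 0)" "(v1 \<longlongrightarrow> 0) (at_right 0)"
      and 2: "system z u2 v2" "(u2 \<longlongrightarrow> 0) (at_right 0)" "(v2 \<longlongrightarrow> 1) (at_right 0)"
      and W: "\<And>x. x > 0 \<Longrightarrow> wronskian u1 v1 u2 v2 x = 1"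
      using fundamental_system by blast
    have W1: "wronskian y w u2 v2 x = 0" if "x > 0" for x
      using tendsto_diff[OF tendsto_mult[OF lim0(1) 2(3)] tendsto_mult[OF 2(2) lim0(2)]]
        eventually_at_right_less that
      by (intro wronskian_eq_limit[OF yw 2(1)]) (auto simp: wronskian_def[abs_def])
    have W2: "wronskian u1 v1 y w x = 0" if "x > 0" for x
      using tendsto_diff[OF tendsto_mult[OF 1(2) lim0(2)] tendsto_mult[OF lim0(1) 1(3)]]
        eventually_at_right_less that
      by (intro wronskian_eq_limit[OF 1(1) yw]) (auto simp: wronskian_def[abs_def])
    have "y x = 0" if "x > 0" for x
      using fundamental_system_expansion[OF W _ W1 W2 that] by simp
    then show "u' = ?u"
      using u' by (intro extensionalityI[of _ "{0<..}"]) (auto simp: y_def solution_def)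
  qed
qed

lemma phi_solution: "solution p q z (phi p q \<alpha> z)"
proof (cases \<alpha>)
  case (Finite r)
  then show ?thesis
    using theI'[OF initial_value_solution_unique[of z 1 "of_real r"]] by (simp add: phi_def)
next
  case Infinite
  then show ?thesis
    using theI'[OF initial_value_solution_unique[of z 0 1]] by (simp add: phi_def)
qed

lemma theta_solution: "solution p q z (theta p q \<alpha> z)"
proof (cases \<alpha>)
  case (Finite r)
  then show ?thesis
    using theI'[OF initial_value_solution_unique[of z 0 "of_real (- inverse (p 0))"]]
    by (simp add: theta_def)
next
  case Infinite
  then show ?thesis
    using theI'[OF initial_value_solution_unique[of z "of_real (inverse (p 0))" 0]]
    by (simp add: theta_def)
qed

end

section \<open>Convergence at infinity by dominated increments\<close>

text \<open>
  The limit is found along the integers, where the increments of the convergent majorant \<open>R\<close>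
  give the Cauchy property; afterwards \<open>l - R x\<close> bounds the distance of \<open>c x\<close> from it.
\<close>

lemma convergent_at_top_if_increments_dominated:
  fixes c :: "real \<Rightarrow> 'a::banach"
  assumes R: "(R \<longlongrightarrow> l) at_top"
    and inc: "\<And>x y. b \<le> x \<Longrightarrow> x \<le> y \<Longrightarrow> norm (c y - c x) \<le> R y - R x"
  obtains L where "(c \<longlongrightarrow> L) at_top"
proof -
  have Rn: "(\<lambda>n. R (real n)) \<longlonglongrightarrow> l"
    by (rule filterlim_compose[OF R filterlim_real_sequentially])
  have "Cauchy (\<lambda>n. c (real n))"
  proof (rule CauchyI)
    fix e :: real assume "e > 0"
    from LIMSEQ_imp_Cauchy[OF Rn, THEN CauchyD, OF this] obtain M
      where M: "\<And>m n. m \<ge> M \<Longrightarrow> n \<ge> M \<Longrightarrow> norm (R (real m) - R (real n)) < e" by blast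
    obtain N where N: "b \<le> real N" using real_arch_simple by blast
    have *: "norm (c (real n) - c (real m)) < e" if "m \<ge> max M N" "n \<ge> m" for m n
    proof -
      have "b \<le> real m" using N that by linarith
      with inc[of "real m" "real n"] M[of n m] that show ?thesis by auto
    qed
    show "\<exists>M. \<forall>m\<ge>M. \<forall>n\<ge>M. norm (c (real m) - c (real n)) < e"
    proof (intro exI[of _ "max M N"] allI impI)
      fix m n assume "m \<ge> max M N" "n \<ge> max M N"
      with *[of m n] *[of n m] show "norm (c (real m) - c (real n)) < e"
        by (cases "m \<le> n") (auto simp: norm_minus_commute)
    qed
  qed
  then obtain L where L: "(\<lambda>n. c (real n)) \<longlonglongrightarrow> L"
    using Cauchy_convergent_iff convergent_def by blast
  have "((\<lambda>x. c x - L) \<longlongrightarrow> 0) at_top"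
  proof (rule Lim_null_comparison)
    show "\<forall>\<^sub>F x in at_top. norm (c x - L) \<le> l - R x"
      using eventually_ge_at_top[of b]
    proof eventually_elim
      case (elim x)
      have "norm (L - c x) \<le> l - R x"
      proof (rule tendsto_le[OF sequentially_bot])
        show "(\<lambda>n. R (real n) - R x) \<longlonglongrightarrow> l - R x" by (intro tendsto_intros Rn)
        show "(\<lambda>n. norm (c (real n) - c x)) \<longlonglongrightarrow> norm (L - c x)" by (intro tendsto_intros L)
        show "\<forall>\<^sub>F n in sequentially. norm (c (real n) - c x) \<le> R (real n) - R x"
          using eventually_ge_at_top[of "nat \<lceil>x\<rceil>"]
          by eventually_elim (use elim inc in \<open>simp add: nat_ceiling_le_eq\<close>)
      qed
      then show ?case by (simp add: norm_minus_commute)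
    qed
    show "((\<lambda>x. l - R x) \<longlongrightarrow> 0) at_top"
      using tendsto_diff[OF tendsto_const[of l] R] by simp
  qed
  then show ?thesis by (intro that[of L]) (rule Lim_null[THEN iffD2])
qed

section \<open>The Liouville--Green coefficients\<close>

locale liouville_green = sturm_liouville p q for p q :: "real \<Rightarrow> real" +
  fixes a' h :: "real \<Rightarrow> real" and x0 :: real
  assumes x0_pos: "x0 > 0"
    and q_pos: "\<forall>x\<ge>x0. q x > 0"
    and a_deriv: "\<forall>x\<ge>x0. (amp p q has_real_derivative a' x) (at x within {x0..})"
    and a'_cont: "continuous_on {x0..} a'"
    and a'_ac: "locally_abs_continuous_on {x0..} a'"
    and pa'_deriv: "has_ae_derivative_on (\<lambda>x. p x * a' x) h {x0<..}"
    and a_L2: "set_integrable lebesgue {x0<..} (\<lambda>x. (amp p q x)\<^sup>2)"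
    and apa'_L1: "set_integrable lebesgue {x0<..} (\<lambda>x. amp p q x * h x)"
    and paa'_lim: "((\<lambda>x. p x * a' x * amp p q x) \<longlongrightarrow> 0) at_top"
begin

abbreviation "a \<equiv> amp p q"

definition phase :: "complex \<Rightarrow> real \<Rightarrow> complex" where
  "phase j x = exp (j * of_real (Xi p q x0 x))"

text \<open>
  The functions \<open>coef \<i> u v\<close> and \<open>coef (- \<i>) u v\<close> are the coefficients \<open>c\<^sub>+\<close> and \<open>c\<^sub>-\<close> determined by
  \<open>u = a (c\<^sub>+ exp (\<i>\<Xi>) + c\<^sub>- exp (-\<i>\<Xi>))\<close> and the requirement that \<open>v\<close> is obtained as if \<open>c\<^sub>+\<close> and
  \<open>c\<^sub>-\<close> were constant. A single formula in \<open>j\<close> with \<open>j\<^sup>2 = -1\<close> serves both signs.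
\<close>

definition coef :: "complex \<Rightarrow> (real \<Rightarrow> complex) \<Rightarrow> (real \<Rightarrow> complex) \<Rightarrow> real \<Rightarrow> complex" where
  "coef j u v x = phase (- j) x *
     (u x * of_real (inverse (a x)) + j * (of_real (p x * a' x) * u x - of_real (a x) * v x)) / 2"

definition weight :: "complex \<Rightarrow> real \<Rightarrow> real" where
  "weight z x = norm (z * of_real ((a x)\<^sup>2) + of_real (a x * h x))"

lemma pq_pos: "x \<ge> x0 \<Longrightarrow> p x > 0 \<and> q x > 0"
  using p_pos q_pos x0_pos by (auto intro: less_imp_le)

lemma a_pos: "x \<ge> x0 \<Longrightarrow> a x > 0"
  using pq_pos[of x] by (simp add: amp_def)

lemma amp_power4:
  assumes "x \<ge> x0"
  shows "(a x) ^ 4 = 1 / (p x * q x)"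
proof -
  have "p x * q x > 0" using pq_pos[OF assms] by simp
  have "(a x) ^ 4 = (p x * q x) powr (- 1)"
    unfolding amp_def power4_eq_xxxx powr_add[symmetric] by simp
  also have "\<dots> = 1 / (p x * q x)" using \<open>p x * q x > 0\<close> by (simp add: powr_minus_divide)
  finally show ?thesis .
qed

lemma q_eq: "x \<ge> x0 \<Longrightarrow> q x = 1 / (p x * (a x) ^ 4)"
  using amp_power4[of x] p_nonzero[of x] q_pos x0_pos by (auto simp: field_simps)

lemma xi_eq:
  assumes "x \<ge> x0"
  shows "xi p q x = 1 / (p x * (a x)\<^sup>2)"
proof -
  have "p x > 0" using assms p_pos x0_pos by simp
  have "q x / p x = (1 / (p x * (a x)\<^sup>2))\<^sup>2"
    unfolding q_eq[OF assms] by (simp add: power2_eq_square power4_eq_xxxx)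
  then show ?thesis
    unfolding xi_def using \<open>p x > 0\<close> by simp
qed

lemma xi_continuous: "continuous_on {x0..} (xi p q)"
  unfolding xi_def[abs_def] using p_nonzero x0_pos
  by (intro continuous_intros continuous_on_subset[OF p_continuous] continuous_on_subset[OF q_continuous]) auto

lemma Xi_deriv:
  assumes "x > x0"
  shows "(Xi p q x0 has_real_derivative xi p q x) (at x)"
proof -
  have "(Xi p q x0 has_real_derivative xi p q x) (at x within {x0..x+1})"
    unfolding Xi_def[abs_def] using assms
    by (intro integral_has_real_derivative continuous_on_subset[OF xi_continuous]) auto
  moreover have "at x within {x0..x+1} = at x"
    using assms by (intro at_within_interior) auto
  ultimately show ?thesis by simp
qed

lemma a_deriv_at:
  assumes "x > x0"
  shows "(a has_real_derivative a' x) (at x)"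
proof -
  have "at x within {x0..} = at x" using assms by (intro at_within_interior) auto
  then show ?thesis using a_deriv assms by (metis less_imp_le)
qed

lemma phase_deriv:
  assumes "x > x0"
  shows "(phase j has_vector_derivative j * of_real (xi p q x) * phase j x) (at x)"
proof -
  have "((\<lambda>x. j * of_real (Xi p q x0 x)) has_vector_derivative j * of_real (xi p q x)) (at x)"
    by (auto intro!: derivative_eq_intros Xi_deriv assms)
  from field_vector_diff_chain_at[OF this DERIV_exp]
  show ?thesis by (simp add: phase_def[abs_def] o_def)
qed

lemma norm_phase [simp]: "norm (phase \<i> x) = 1" "norm (phase (- \<i>) x) = 1"
  using norm_exp_i_times[of "Xi p q x0 x"] norm_exp_i_times[of "- Xi p q x0 x"]
  by (simp_all add: phase_def)

lemma phase_inverse: "phase \<i> x * phase (- \<i>) x = 1"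
  by (simp add: phase_def flip: exp_add)

lemma reconstruct:
  assumes "x \<ge> x0"
  shows "u x = of_real (a x) * (coef \<i> u v x * phase \<i> x + coef (- \<i>) u v x * phase (- \<i>) x)"
    and "v x = (of_real (p x * a' x) * u x +
           \<i> * (coef \<i> u v x * phase \<i> x - coef (- \<i>) u v x * phase (- \<i>) x)) / of_real (a x)"
proof -
  have a: "complex_of_real (a x) \<noteq> 0" using a_pos[OF assms] by simp
  let ?w = "of_real (p x * a' x) * u x - of_real (a x) * v x"
  have "coef \<i> u v x * phase \<i> x =
      (phase \<i> x * phase (- \<i>) x) * (u x * of_real (inverse (a x)) + \<i> * ?w) / 2"
    unfolding coef_def by (simp only: times_divide_eq_left times_divide_eq_right ac_simps)
  then have 1: "coef \<i> u v x * phase \<i> x = (u x * of_real (inverse (a x)) + \<i> * ?w) / 2"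
    by (simp only: phase_inverse mult_1)
  have "coef (- \<i>) u v x * phase (- \<i>) x =
      (phase \<i> x * phase (- \<i>) x) * (u x * of_real (inverse (a x)) + - \<i> * ?w) / 2"
    unfolding coef_def minus_minus
    by (simp only: times_divide_eq_left times_divide_eq_right ac_simps)
  then have 2: "coef (- \<i>) u v x * phase (- \<i>) x = (u x * of_real (inverse (a x)) + - \<i> * ?w) / 2"
    by (simp only: phase_inverse mult_1)
  show "u x = of_real (a x) * (coef \<i> u v x * phase \<i> x + coef (- \<i>) u v x * phase (- \<i>) x)"
    unfolding 1 2 using a by (simp add: field_simps)
  show "v x = (of_real (p x * a' x) * u x +
           \<i> * (coef \<i> u v x * phase \<i> x - coef (- \<i>) u v x * phase (- \<i>) x)) / of_real (a x)"
    unfolding 1 2 using a by (simp add: field_simps)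
qed

text \<open>
  The change of variables from \<open>(u, v)\<close> to the coefficients has the constant determinant \<open>-2\<i>\<close>,
  the Wronskian of the two approximate solutions \<open>a exp (\<plusminus>\<i>\<Xi>)\<close>.
\<close>

lemma coef_wronskian:
  assumes "x \<ge> x0"
  shows "wronskian u1 v1 u2 v2 x =
    - 2 * \<i> * (coef \<i> u1 v1 x * coef (- \<i>) u2 v2 x - coef (- \<i>) u1 v1 x * coef \<i> u2 v2 x)"
proof -
  have a: "complex_of_real (a x) \<noteq> 0" using a_pos[OF assms] by simp
  let ?P = "complex_of_real (p x * a' x)"
  let ?w1 = "?P * u1 x - of_real (a x) * v1 x" and ?w2 = "?P * u2 x - of_real (a x) * v2 x"
  have "coef \<i> u1 v1 x * coef (- \<i>) u2 v2 x - coef (- \<i>) u1 v1 x * coef \<i> u2 v2 x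
      = (phase \<i> x * phase (- \<i>) x) *
        ((u1 x * of_real (inverse (a x)) + \<i> * ?w1) * (u2 x * of_real (inverse (a x)) + - \<i> * ?w2)
         - (u1 x * of_real (inverse (a x)) + - \<i> * ?w1) * (u2 x * of_real (inverse (a x)) + \<i> * ?w2)) / 4"
    (is "_ = _ * (?g1 * ?g2' - ?g1' * ?g2) / 4")
  proof -
    have "F * G / 2 * (E * K' / 2) - E * G' / 2 * (F * K / 2) = (E * F) * (G * K' - G' * K) / 4"
      for E F G G' K K' :: complex
      by (simp add: field_simps)
    then show ?thesis unfolding coef_def minus_minus .
  qed
  also have "\<dots> = \<i> / 2 * wronskian u1 v1 u2 v2 x"
    unfolding phase_inverse wronskian_def using a by (simp add: field_simps)
  finally have *: "coef \<i> u1 v1 x * coef (- \<i>) u2 v2 x - coef (- \<i>) u1 v1 x * coef \<i> u2 v2 x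
      = \<i> / 2 * wronskian u1 v1 u2 v2 x" .
  show ?thesis unfolding * by simp
qed

text \<open>
  The cancellation behind the choice of \<open>a\<close> and \<open>\<Xi>\<close>: here \<open>P, A, A', X, Q, H\<close> stand for the values
  of \<open>p\<close>, \<open>a\<close>, \<open>a'\<close>, \<open>\<Xi>'\<close>, \<open>q\<close> and \<open>(p a')'\<close>. By \<open>\<Xi>' = 1 / (p a\<^sup>2)\<close> and \<open>q = 1 / (p a\<^sup>4)\<close> all terms
  without \<open>z\<close> or \<open>H\<close> cancel.
\<close>

lemma coef_deriv_algebra:
  fixes j P A A' X Q z H u v E :: complex
  assumes "P \<noteq> 0" "A \<noteq> 0" "j * j = -1" "X = 1 / (P * A\<^sup>2)" "Q = 1 / (P * A ^ 4)"
  shows "(E * (u * - (A' / A\<^sup>2) + v / P * inverse A +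
       j * ((P * A') * (v / P) + H * u - (A * (- (Q + z) * u) + A' * v)))
     + (- j) * X * E * (u * inverse A + j * (P * A' * u - A * v))) / 2
    = j / 2 * E * (z * A + H) * u"
proof -
  have j2: "j\<^sup>2 = -1" using assms(3) by (simp add: power2_eq_square)
  have "(- j) * X * E * (u * inverse A + j * (P * A' * u - A * v))
     = - j * X * E * u * inverse A - (j * j) * X * E * (P * A' * u - A * v)"
    by (simp add: algebra_simps)
  also have "\<dots> = E * (- j * u / (P * A ^ 3) + A' * u / A\<^sup>2 - v / (P * A))"
    unfolding assms(3-4) using assms(1,2)
    by (simp add: field_simps power2_eq_square power3_eq_cube)
  finally have 1: "(- j) * X * E * (u * inverse A + j * (P * A' * u - A * v))
     = E * (- j * u / (P * A ^ 3) + A' * u / A\<^sup>2 - v / (P * A))" .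
  have 2: "u * - (A' / A\<^sup>2) + v / P * inverse A +
       j * ((P * A') * (v / P) + H * u - (A * (- (Q + z) * u) + A' * v))
     = - (A' * u / A\<^sup>2) + v / (P * A) + j * H * u + j * u / (P * A ^ 3) + j * A * z * u"
    unfolding assms(5) using assms(1,2)
    by (simp add: field_simps power2_eq_square power3_eq_cube power4_eq_xxxx)
  show ?thesis unfolding 1 2 by (simp add: algebra_simps)
qed

lemma coef_deriv:
  assumes s: "system z u v" and x: "x > x0" and j: "j * j = -1"
    and h: "((\<lambda>x. p x * a' x) has_real_derivative h x) (at x)"
  shows "(coef j u v has_vector_derivative
     j / 2 * phase (- j) x * (z * of_real (a x) + of_real (h x)) * u x) (at x)"
proof -
  have x': "x > 0" "x \<ge> x0" using x x0_pos by auto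
  have ax: "a x \<noteq> 0" using a_pos[OF x'(2)] by simp
  have U: "(u has_vector_derivative v x / of_real (p x)) (at x)"
    and V: "(v has_vector_derivative - (of_real (q x) + z) * u x) (at x)"
    using s x'(1) by (auto simp: system_def)
  note A = has_vector_derivative_of_real[OF a_deriv_at[OF x]]
  have "((\<lambda>x. inverse (a x)) has_real_derivative - (a' x / (a x)\<^sup>2)) (at x)"
    using ax by (auto intro!: derivative_eq_intros a_deriv_at[OF x] simp: power2_eq_square field_simps)
  note IA = has_vector_derivative_of_real[OF this]
  note H = has_vector_derivative_of_real[OF h]
  note E = phase_deriv[OF x, of "- j"]
  let ?g = "\<lambda>x. u x * of_real (inverse (a x)) + j * (of_real (p x * a' x) * u x - of_real (a x) * v x)"
  have G: "(?g has_vector_derivative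
      u x * of_real (- (a' x / (a x)\<^sup>2)) + v x / of_real (p x) * of_real (inverse (a x)) +
      j * ((of_real (p x * a' x) * (v x / of_real (p x)) + of_real (h x) * u x)
        - (of_real (a x) * (- (of_real (q x) + z) * u x) + of_real (a' x) * v x))) (at x)"
    by (intro has_vector_derivative_add has_vector_derivative_mult has_vector_derivative_diff
        has_vector_derivative_mult_right U V A IA H)
  have "(coef j u v has_vector_derivative
     (phase (- j) x * (u x * of_real (- (a' x / (a x)\<^sup>2)) + v x / of_real (p x) * of_real (inverse (a x)) +
      j * ((of_real (p x * a' x) * (v x / of_real (p x)) + of_real (h x) * u x)
        - (of_real (a x) * (- (of_real (q x) + z) * u x) + of_real (a' x) * v x)))
      + - j * of_real (xi p q x) * phase (- j) x * ?g x) / 2) (at x)"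
    unfolding coef_def[abs_def]
    by (intro has_vector_derivative_divide has_vector_derivative_mult E G)
  moreover have "(phase (- j) x * (u x * of_real (- (a' x / (a x)\<^sup>2)) + v x / of_real (p x) * of_real (inverse (a x)) +
      j * ((of_real (p x * a' x) * (v x / of_real (p x)) + of_real (h x) * u x)
        - (of_real (a x) * (- (of_real (q x) + z) * u x) + of_real (a' x) * v x)))
      + - j * of_real (xi p q x) * phase (- j) x * ?g x) / 2
     = j / 2 * phase (- j) x * (z * of_real (a x) + of_real (h x)) * u x"
    using coef_deriv_algebra[of "of_real (p x)" "of_real (a x)" j "of_real (xi p q x)"
        "of_real (q x)" "phase (- j) x" "u x" "of_real (a' x)" "v x" "of_real (h x)" z]
      ax p_nonzero[of x] x' j xi_eq[of x] q_eq[of x]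
    by (simp add: of_real_divide of_real_mult)
  ultimately show ?thesis by (simp only:)
qed

text \<open>
  Every factor of the coefficient is continuously differentiable except \<open>a'\<close>, which is
  absolutely continuous by hypothesis.
\<close>

lemma coef_abs_cont:
  assumes s: "system z u v" and cd: "x0 < c"
  shows "abs_cont_on {c..d} (coef j u v)"
proof -
  have c0: "c > 0" using cd x0_pos by simp
  have sub: "{c..d} \<subseteq> {x0..}" "{c..d} \<subseteq> {0..}" "{c..d} \<subseteq> {0<..}" using cd c0 by auto
  have U: "(u has_vector_derivative v x / of_real (p x)) (at x within {c..d})"
    and V: "(v has_vector_derivative - (of_real (q x) + z) * u x) (at x within {c..d})"
    if "x \<in> {c..d}" for x
  proof -
    have "x > 0" using that c0 by simp
    with s show "(u has_vector_derivative v x / of_real (p x)) (at x within {c..d})"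
        "(v has_vector_derivative - (of_real (q x) + z) * u x) (at x within {c..d})"
      unfolding system_def by (blast intro: has_vector_derivative_at_within)+
  qed
  have uc: "continuous_on {c..d} u" by (rule continuous_on_vector_derivative[OF U])
  have vc: "continuous_on {c..d} v" by (rule continuous_on_vector_derivative[OF V])
  have pc: "continuous_on {c..d} p" and qc: "continuous_on {c..d} q"
    using p_continuous q_continuous sub by (auto intro: continuous_on_subset)
  have xic: "continuous_on {c..d} (xi p q)" and a'c: "continuous_on {c..d} a'"
    using xi_continuous a'_cont sub by (auto intro: continuous_on_subset)
  have ad: "(a has_real_derivative a' x) (at x)" and an: "a x \<noteq> 0" if "x \<in> {c..d}" for x
    using that cd a_deriv_at a_pos[of x] by auto
  have ac: "continuous_on {c..d} a"
    using ad by (intro DERIV_continuous_on[of _ _ a']) (blast intro: has_field_derivative_at_within)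
  obtain p' where p': "\<And>x. x > 0 \<Longrightarrow> (p has_vector_derivative p' x) (at x)" "continuous_on {0<..} p'"
    using p_C1 unfolding C1_differentiable_on_def by auto
  have 1: "abs_cont_on {c..d} u"
  proof (rule abs_cont_on_C1[OF U])
    have "\<forall>x\<in>{c..d}. complex_of_real (p x) \<noteq> 0" using p_nonzero sub by auto
    then show "continuous_on {c..d} (\<lambda>x. v x / of_real (p x))"
      by (intro continuous_intros vc pc)
  qed
  have 2: "abs_cont_on {c..d} v"
  proof (rule abs_cont_on_C1[OF V])
    show "continuous_on {c..d} (\<lambda>x. - (of_real (q x) + z) * u x)"
      by (intro continuous_intros uc qc)
  qed
  have 3: "abs_cont_on {c..d} (phase (- j))"
  proof (rule abs_cont_on_C1[where f' = "\<lambda>x. - j * of_real (xi p q x) * phase (- j) x"])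
    show *: "(phase (- j) has_vector_derivative - j * of_real (xi p q x) * phase (- j) x) (at x within {c..d})"
      if "x \<in> {c..d}" for x
      by (rule has_vector_derivative_at_within[OF phase_deriv]) (use that cd in auto)
    have "continuous_on {c..d} (phase (- j))"
      by (rule continuous_on_vector_derivative[OF *])
    note ph = this
    show "continuous_on {c..d} (\<lambda>x. - j * of_real (xi p q x) * phase (- j) x)"
      by (intro continuous_on_mult continuous_on_const continuous_on_of_real xic ph)
  qed
  have 4: "abs_cont_on {c..d} (\<lambda>x. complex_of_real (a x))"
  proof (rule abs_cont_on_C1[where f' = "\<lambda>x. of_real (a' x)"])
    show "((\<lambda>x. complex_of_real (a x)) has_vector_derivative of_real (a' x)) (at x within {c..d})"
      if "x \<in> {c..d}" for x
      by (rule has_vector_derivative_at_within[OF has_vector_derivative_of_real[OF ad[OF that]]])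
    show "continuous_on {c..d} (\<lambda>x. complex_of_real (a' x))"
      by (intro continuous_intros a'c)
  qed
  have 5: "abs_cont_on {c..d} (\<lambda>x. complex_of_real (inverse (a x)))"
  proof (rule abs_cont_on_C1[where f' = "\<lambda>x. of_real (- (a' x / (a x)\<^sup>2))"])
    show "((\<lambda>x. complex_of_real (inverse (a x))) has_vector_derivative of_real (- (a' x / (a x)\<^sup>2)))
        (at x within {c..d})" if "x \<in> {c..d}" for x
    proof (rule has_vector_derivative_at_within[OF has_vector_derivative_of_real])
      show "((\<lambda>x. inverse (a x)) has_real_derivative - (a' x / (a x)\<^sup>2)) (at x)"
        using DERIV_inverse_fun[OF ad an, OF that that]
        by (simp add: power2_eq_square field_simps)
    qed
    have "\<forall>x\<in>{c..d}. (a x)\<^sup>2 \<noteq> 0" using an by simp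
    then show "continuous_on {c..d} (\<lambda>x. complex_of_real (- (a' x / (a x)\<^sup>2)))"
      by (intro continuous_intros a'c ac)
  qed
  have 6: "abs_cont_on {c..d} (\<lambda>x. complex_of_real (p x))"
  proof (rule abs_cont_on_C1[where f' = "\<lambda>x. of_real (p' x)"])
    show "((\<lambda>x. complex_of_real (p x)) has_vector_derivative of_real (p' x)) (at x within {c..d})"
      if "x \<in> {c..d}" for x
      using p'(1)[of x] that c0
      by (intro has_vector_derivative_at_within[OF has_vector_derivative_of_real])
         (simp add: has_real_derivative_iff_has_vector_derivative)
    show "continuous_on {c..d} (\<lambda>x. complex_of_real (p' x))"
      by (intro continuous_intros continuous_on_subset[OF p'(2) sub(3)])
  qed
  have 7: "abs_cont_on {c..d} (\<lambda>x. complex_of_real (a' x))"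
    using a'_ac sub by (intro abs_cont_on_of_real) (auto simp: locally_abs_continuous_on_def)
  have const: "abs_cont_on {c..d} (\<lambda>x. k)" for k :: complex
    by (rule abs_cont_on_lipschitz[where B = 0]) simp
  have "abs_cont_on {c..d} (\<lambda>x. phase (- j) x * (u x * of_real (inverse (a x)) +
      j * (of_real (p x) * of_real (a' x) * u x + (- 1) * (of_real (a x) * v x))) * (1 / 2))"
    by (intro abs_cont_on_add abs_cont_on_mult_Icc 1 2 3 4 5 6 7 const)
  then show ?thesis by (simp add: coef_def[abs_def])
qed

lemma coef_increment:
  assumes s: "system z u v" and cd: "x0 < c" "c \<le> d" and j: "j * j = -1"
  shows "((\<lambda>x. j / 2 * phase (- j) x * (z * of_real (a x) + of_real (h x)) * u x)
    has_integral (coef j u v d - coef j u v c)) {c..d}"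
proof -
  obtain N where N: "N \<in> null_sets lebesgue"
    "{x \<in> space lebesgue. \<not> (x \<in> {x0<..} \<longrightarrow> ((\<lambda>x. p x * a' x) has_real_derivative h x) (at x))} \<subseteq> N"
    using pa'_deriv unfolding has_ae_derivative_on_def eventually_ae_filter by blast
  show ?thesis
  proof (rule fundamental_theorem_of_calculus_abs_cont[OF cd(2) coef_abs_cont[OF s cd(1)]])
    show "negligible N" using N by (simp add: negligible_iff_null_sets)
    fix x assume x: "x \<in> {c..d} - N"
    then have gt: "x > x0" using cd by simp
    with N(2) x have d: "((\<lambda>x. p x * a' x) has_real_derivative h x) (at x)" by auto
    from has_vector_derivative_at_within[OF coef_deriv[OF s gt j d]]
    show "(coef j u v has_vector_derivative
        j / 2 * phase (- j) x * (z * of_real (a x) + of_real (h x)) * u x) (at x within {c..d})"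
      .
  qed
qed

section \<open>Limits of the coefficients at infinity\<close>

lemma weight_integrable: "weight z integrable_on {x0<..}"
proof -
  have "((\<lambda>t. z * of_real t) \<circ> (\<lambda>x. (a x)\<^sup>2)) absolutely_integrable_on {x0<..}"
    by (intro absolutely_integrable_linear a_L2 bounded_linear_mult_right
        bounded_linear_compose[OF bounded_linear_mult_right bounded_linear_of_real])
  moreover have "(complex_of_real \<circ> (\<lambda>x. a x * h x)) absolutely_integrable_on {x0<..}"
    by (intro absolutely_integrable_linear apa'_L1 bounded_linear_of_real)
  ultimately have "(\<lambda>x. z * of_real ((a x)\<^sup>2) + of_real (a x * h x)) absolutely_integrable_on {x0<..}"
    unfolding o_def by (rule set_integral_add(1))
  then show ?thesis
    unfolding absolutely_integrable_on_def weight_def[abs_def] by blast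
qed

lemma weight_integrable_Icc: "x0 < c \<Longrightarrow> weight z integrable_on {c..d}"
  by (rule integrable_on_subinterval[OF weight_integrable]) auto

lemma weight_nonneg: "weight z x \<ge> 0"
  by (simp add: weight_def)

text \<open>
  The primitive \<open>R\<close> of the integrable weight converges, being increasing and bounded; it serves
  as the majorant for the increments of the coefficients.
\<close>

lemma weight_tail:
  obtains R l where "(R \<longlongrightarrow> l) at_top"
    "\<And>c d. x0 + 1 \<le> c \<Longrightarrow> c \<le> d \<Longrightarrow> integral {c..d} (weight z) = R d - R c"
proof -
  define R where "R y = integral {x0+1..y} (weight z)" for y
  have comb: "integral {c..d} (weight z) = R d - R c" if "x0 + 1 \<le> c" "c \<le> d" for c d
    using Henstock_Kurzweil_Integration.integral_combine[OF that weight_integrable_Icc, of z]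
    by (simp add: R_def)
  have mono: "R c \<le> R d" if "x0 + 1 \<le> c" "c \<le> d" for c d
    using comb[OF that] that integral_nonneg[OF weight_integrable_Icc[of c z d] weight_nonneg] by simp
  have bdd: "R y \<le> integral {x0<..} (weight z)" for y
    unfolding R_def
    by (rule integral_subset_le) (auto simp: weight_nonneg weight_integrable weight_integrable_Icc)
  define l where "l = (SUP y\<in>{x0+1..}. R y)"
  have bdd': "bdd_above (R ` {x0+1..})" by (rule bdd_aboveI2) (rule bdd)
  have "(R \<longlongrightarrow> l) at_top"
  proof (rule increasing_tendsto)
    show "\<forall>\<^sub>F n in at_top. R n \<le> l"
      using eventually_ge_at_top[of "x0+1"]
      by eventually_elim (auto simp: l_def intro!: cSUP_upper bdd')
    fix t assume "t < l"
    then obtain y where y: "y \<ge> x0 + 1" "t < R y"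
      using less_cSUP_iff[OF _ bdd', of t] by (auto simp: l_def)
    show "\<forall>\<^sub>F n in at_top. t < R n"
      using eventually_ge_at_top[of y] by eventually_elim (use y mono in fastforce)
  qed
  then show ?thesis using comb that by blast
qed

text \<open>
  The phases have modulus one and \<open>\<bar>u\<bar> \<le> a (\<bar>c\<^sub>+\<bar> + \<bar>c\<^sub>-\<bar>)\<close>, so one factor \<open>a\<close> turns
  \<open>\<bar>z a + (p a')'\<bar>\<close> into the integrable weight.
\<close>

lemma coef_increment_bound:
  assumes s: "system z u v" and cd: "x0 < c" "c \<le> d" and j: "j = \<i> \<or> j = - \<i>"
    and M: "\<And>x. x \<in> {c..d} \<Longrightarrow> norm (coef \<i> u v x) + norm (coef (- \<i>) u v x) \<le> M"
  shows "norm (coef j u v d - coef j u v c) \<le> M / 2 * integral {c..d} (weight z)"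
proof -
  let ?g = "\<lambda>x. j / 2 * phase (- j) x * (z * of_real (a x) + of_real (h x)) * u x"
  have "j * j = -1" using j by auto
  note int = coef_increment[OF s cd this]
  have "norm (coef j u v d - coef j u v c) = norm (integral {c..d} ?g)"
    by (simp only: integral_unique[OF int])
  also have "\<dots> \<le> integral {c..d} (\<lambda>x. M / 2 * weight z x)"
  proof (rule integral_norm_bound_integral)
    show "?g integrable_on {c..d}" using int by blast
    show "(\<lambda>x. M / 2 * weight z x) integrable_on {c..d}"
      using weight_integrable_Icc[OF cd(1)] by (rule integrable_on_mult_right)
    fix x assume x: "x \<in> {c..d}"
    then have x': "x \<ge> x0" using cd by simp
    have ax: "a x > 0" using a_pos[OF x'] .
    have "norm (u x) = a x * norm (coef \<i> u v x * phase \<i> x + coef (- \<i>) u v x * phase (- \<i>) x)"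
      using ax by (subst reconstruct(1)[OF x', of u v]) (simp add: norm_mult)
    also have "\<dots> \<le> a x * M"
      using ax M[OF x]
      by (intro mult_left_mono order_trans[OF norm_triangle_ineq]) (auto simp: norm_mult)
    finally have u: "norm (u x) \<le> a x * M" .
    have "norm (?g x) = 1 / 2 * norm (z * of_real (a x) + of_real (h x)) * norm (u x)"
      using j by (auto simp: norm_mult norm_divide)
    also have "\<dots> \<le> 1 / 2 * norm (z * of_real (a x) + of_real (h x)) * (a x * M)"
      using u by (intro mult_left_mono) auto
    also have "\<dots> = M / 2 * norm (of_real (a x) * (z * of_real (a x) + of_real (h x)))"
      using ax by (simp add: norm_mult)
    also have "\<dots> = M / 2 * weight z x"
      by (simp add: weight_def algebra_simps power2_eq_square)
    finally show "norm (?g x) \<le> M / 2 * weight z x" .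
  qed
  also have "\<dots> = M / 2 * integral {c..d} (weight z)" by simp
  finally show ?thesis .
qed

text \<open>
  Start so far out, at \<open>b\<close>, that the remaining integral of the weight is at most \<open>1/2\<close>. On any
  interval \<open>[b, x]\<close> the maximum \<open>S t\<close> of \<open>\<bar>c\<^sub>+\<bar> + \<bar>c\<^sub>-\<bar>\<close> then satisfies \<open>S t \<le> S b + S t / 2\<close>, so
  \<open>2 * S b\<close> is a bound on all of \<open>[b, \<infinity>)\<close>. Now the increments are dominated by those of a
  multiple of the convergent primitive of the weight.
\<close>

lemma coef_convergent:
  assumes s: "system z u v"
  obtains L1 L2 where "(coef \<i> u v \<longlongrightarrow> L1) at_top" "(coef (- \<i>) u v \<longlongrightarrow> L2) at_top"
proof -
  obtain R l where R: "(R \<longlongrightarrow> l) at_top"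
    "\<And>c d. x0 + 1 \<le> c \<Longrightarrow> c \<le> d \<Longrightarrow> integral {c..d} (weight z) = R d - R c"
    using weight_tail by blast
  let ?S = "\<lambda>x. norm (coef \<i> u v x) + norm (coef (- \<i>) u v x)"
  have "\<forall>\<^sub>F x in at_top. R x > l - 1 / 4 \<and> R x < l + 1 / 4 \<and> x \<ge> x0 + 1"
    using R(1) by (intro eventually_conj order_tendstoD eventually_ge_at_top) auto
  then obtain b where b: "\<And>x. x \<ge> b \<Longrightarrow> R x > l - 1 / 4 \<and> R x < l + 1 / 4 \<and> x \<ge> x0 + 1"
    unfolding eventually_at_top_linorder by blast
  have bx0: "b \<ge> x0 + 1" using b[of b] by simp
  have small: "integral {b..t} (weight z) \<le> 1 / 2" if "t \<ge> b" for t
    using b[of b] b[of t] R(2)[OF bx0 that] that by simp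
  define M where "M = 2 * ?S b"
  have bound: "?S x \<le> M" if "x \<ge> b" for x
  proof -
    have "continuous_on {b..x} ?S"
      using bx0 by (intro continuous_intros abs_cont_on_imp_continuous_on coef_abs_cont[OF s]) auto
    from continuous_attains_sup[OF compact_Icc _ this] that
    obtain t where t: "t \<in> {b..x}" "\<And>y. y \<in> {b..x} \<Longrightarrow> ?S y \<le> ?S t" by auto
    have inc: "norm (coef j u v t - coef j u v b) \<le> ?S t / 4" if "j = \<i> \<or> j = - \<i>" for j
    proof -
      have "norm (coef j u v t - coef j u v b) \<le> ?S t / 2 * integral {b..t} (weight z)"
        using t bx0 that by (intro coef_increment_bound[OF s]) auto
      also have "\<dots> \<le> ?S t / 2 * (1 / 2)"
        using small[of t] t by (intro mult_left_mono) auto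
      finally show ?thesis by simp
    qed
    have "?S t \<le> ?S b + ?S t / 2"
      using inc[OF disjI1[OF refl]] inc[OF disjI2[OF refl]] norm_triangle_sub[of "coef \<i> u v t" "coef \<i> u v b"]
        norm_triangle_sub[of "coef (- \<i>) u v t" "coef (- \<i>) u v b"] by linarith
    moreover have "r \<le> 2 * r'" if "r \<le> r' + r / 2" for r r' :: real
      using that by simp
    ultimately have "?S t \<le> M" unfolding M_def by blast
    with t(2)[of x] that show ?thesis by simp
  qed
  have R': "((\<lambda>x. M / 2 * R x) \<longlongrightarrow> M / 2 * l) at_top"
    by (intro tendsto_intros R(1))
  have inc: "norm (coef j u v d - coef j u v c) \<le> M / 2 * R d - M / 2 * R c"
    if "j = \<i> \<or> j = - \<i>" "b \<le> c" "c \<le> d" for j c d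
  proof -
    have "norm (coef j u v d - coef j u v c) \<le> M / 2 * integral {c..d} (weight z)"
      using bx0 that bound by (intro coef_increment_bound[OF s]) auto
    also have "integral {c..d} (weight z) = R d - R c"
      using bx0 that by (intro R(2)) auto
    also have "M / 2 * (R d - R c) = M / 2 * R d - M / 2 * R c"
      by (rule right_diff_distrib)
    finally show ?thesis .
  qed
  obtain L1 where "(coef \<i> u v \<longlongrightarrow> L1) at_top"
    using convergent_at_top_if_increments_dominated[OF R' inc] by blast
  moreover obtain L2 where "(coef (- \<i>) u v \<longlongrightarrow> L2) at_top"
    using convergent_at_top_if_increments_dominated[OF R' inc] by blast
  ultimately show ?thesis using that by blast
qed

text \<open>
  This identity makes passing to the limits at infinity an injective, hence bijective, map on the
  two-dimensional space of solutions.
\<close>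

lemma wronskian_limits:
  assumes s: "system z u1 v1" "system z u2 v2"
    and "(coef \<i> u1 v1 \<longlongrightarrow> c1) at_top" "(coef (- \<i>) u1 v1 \<longlongrightarrow> d1) at_top"
    and "(coef \<i> u2 v2 \<longlongrightarrow> c2) at_top" "(coef (- \<i>) u2 v2 \<longlongrightarrow> d2) at_top"
    and "x > 0"
  shows "wronskian u1 v1 u2 v2 x = - 2 * \<i> * (c1 * d2 - d1 * c2)"
proof (rule wronskian_eq_limit[OF s _ _ _ \<open>x > 0\<close>])
  have "((\<lambda>x. - 2 * \<i> * (coef \<i> u1 v1 x * coef (- \<i>) u2 v2 x - coef (- \<i>) u1 v1 x * coef \<i> u2 v2 x))
     \<longlongrightarrow> - 2 * \<i> * (c1 * d2 - d1 * c2)) at_top"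
    by (intro tendsto_intros assms)
  moreover have "\<forall>\<^sub>F x in at_top. - 2 * \<i> * (coef \<i> u1 v1 x * coef (- \<i>) u2 v2 x -
      coef (- \<i>) u1 v1 x * coef \<i> u2 v2 x) = wronskian u1 v1 u2 v2 x"
    using eventually_ge_at_top[of x0] by eventually_elim (simp add: coef_wronskian)
  ultimately show "(wronskian u1 v1 u2 v2 \<longlongrightarrow> - 2 * \<i> * (c1 * d2 - d1 * c2)) at_top"
    by (rule Lim_transform_eventually)
qed (auto intro: eventually_gt_at_top)

lemma coef_lincomb:
  "coef j (\<lambda>x. c * u1 x + d * u2 x) (\<lambda>x. c * v1 x + d * v2 x) x
     = c * coef j u1 v1 x + d * coef j u2 v2 x"
proof -
  have "E * ((c * U1 + d * U2) * I + j * (P * (c * U1 + d * U2) - A * (c * V1 + d * V2))) / 2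
    = c * (E * (U1 * I + j * (P * U1 - A * V1)) / 2) + d * (E * (U2 * I + j * (P * U2 - A * V2)) / 2)"
    for E U1 U2 V1 V2 A I P :: complex
    by (simp add: field_simps)
  then show ?thesis unfolding coef_def .
qed

lemma coef_lincomb_tendsto:
  assumes "(coef j u1 v1 \<longlongrightarrow> l1) F" "(coef j u2 v2 \<longlongrightarrow> l2) F"
  shows "(coef j (\<lambda>x. c * u1 x + d * u2 x) (\<lambda>x. c * v1 x + d * v2 x) \<longlongrightarrow> c * l1 + d * l2) F"
  unfolding coef_lincomb[abs_def] by (intro tendsto_intros assms)

lemma coef_tendsto_cong:
  assumes "\<And>x. x > 0 \<Longrightarrow> u x = u' x" "\<And>x. x > 0 \<Longrightarrow> v x = v' x" "(coef j u v \<longlongrightarrow> l) at_top"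
  shows "(coef j u' v' \<longlongrightarrow> l) at_top"
proof (rule Lim_transform_eventually[OF assms(3)])
  show "\<forall>\<^sub>F x in at_top. coef j u v x = coef j u' v' x"
    using eventually_gt_at_top[of 0] by eventually_elim (simp add: coef_def assms)
qed

lemma coef_cnj: "coef j (\<lambda>x. cnj (u x)) (\<lambda>x. cnj (v x)) x = cnj (coef (cnj j) u v x)"
  by (simp add: coef_def phase_def exp_cnj)

lemma tendsto_zero_phase:
  assumes "(g \<longlongrightarrow> 0) F" "j = \<i> \<or> j = - \<i>"
  shows "((\<lambda>x. phase j x * g x) \<longlongrightarrow> 0) F"
proof -
  have "((\<lambda>x. norm (phase j x * g x)) \<longlongrightarrow> 0) F"
    using tendsto_norm_zero[OF assms(1)] assms(2) by (auto simp: norm_mult)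
  then show ?thesis by (rule tendsto_norm_zero_cancel)
qed

section \<open>Asymptotics in terms of the coefficients\<close>

lemma solution_asymptotics:
  assumes s: "solution p q z u"
    and L1: "(coef \<i> u (quasi_deriv u) \<longlongrightarrow> L1) at_top"
    and L2: "(coef (- \<i>) u (quasi_deriv u) \<longlongrightarrow> L2) at_top"
  shows "\<exists>\<epsilon>. (\<epsilon> \<longlongrightarrow> 0) at_top \<and> (\<forall>x\<ge>x0. u x = of_real (a x) *
      (L1 * exp (\<i> * of_real (Xi p q x0 x)) + L2 * exp (- \<i> * of_real (Xi p q x0 x)) + \<epsilon> x))"
    (is "\<exists>\<epsilon>. ?A \<epsilon>")
  and "\<exists>\<epsilon>. (\<epsilon> \<longlongrightarrow> 0) at_top \<and> (\<forall>x\<ge>x0. vector_derivative u (at x) =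
      \<i> * of_real (xi p q x) * of_real (a x) *
      (L1 * exp (\<i> * of_real (Xi p q x0 x)) - L2 * exp (- \<i> * of_real (Xi p q x0 x)) + \<epsilon> x))"
    (is "\<exists>\<epsilon>. ?B \<epsilon>")
proof -
  let ?v = "quasi_deriv u"
  let ?c = "coef \<i> u ?v" and ?d = "coef (- \<i>) u ?v"
  have c0: "((\<lambda>x. ?c x - L1) \<longlongrightarrow> 0) at_top" and d0: "((\<lambda>x. ?d x - L2) \<longlongrightarrow> 0) at_top"
    using L1 L2 by (simp_all flip: Lim_null)
  have P0: "((\<lambda>x. complex_of_real (p x * a' x * a x)) \<longlongrightarrow> 0) at_top"
    using tendsto_of_real[OF paa'_lim, where 'a = complex] by simp
  show "\<exists>\<epsilon>. ?A \<epsilon>"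
  proof (intro exI[of _ "\<lambda>x. phase \<i> x * (?c x - L1) + phase (- \<i>) x * (?d x - L2)"] conjI allI impI)
    show "((\<lambda>x. phase \<i> x * (?c x - L1) + phase (- \<i>) x * (?d x - L2)) \<longlongrightarrow> 0) at_top"
      by (rule tendsto_add_zero) (auto intro!: tendsto_zero_phase c0 d0)
    fix x assume x: "x \<ge> x0"
    show "u x = of_real (a x) * (L1 * exp (\<i> * of_real (Xi p q x0 x)) +
        L2 * exp (- \<i> * of_real (Xi p q x0 x)) + (phase \<i> x * (?c x - L1) + phase (- \<i>) x * (?d x - L2)))"
      using reconstruct(1)[OF x, of u ?v] unfolding phase_def[symmetric] by (simp add: algebra_simps)
  qed
  show "\<exists>\<epsilon>. ?B \<epsilon>"
  proof (intro exI[of _ "\<lambda>x. phase \<i> x * ((?c x - L1) - \<i> * (of_real (p x * a' x * a x) * ?c x))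
      + phase (- \<i>) x * (- (?d x - L2) - \<i> * (of_real (p x * a' x * a x) * ?d x))"] conjI allI impI)
    have "((\<lambda>x. (?c x - L1) - \<i> * (of_real (p x * a' x * a x) * ?c x)) \<longlongrightarrow> 0 - \<i> * (0 * L1)) at_top"
      "((\<lambda>x. - (?d x - L2) - \<i> * (of_real (p x * a' x * a x) * ?d x)) \<longlongrightarrow> - 0 - \<i> * (0 * L2)) at_top"
      by (intro tendsto_diff tendsto_minus tendsto_mult tendsto_const c0 d0 P0 L1 L2)+
    then show "((\<lambda>x. phase \<i> x * ((?c x - L1) - \<i> * (of_real (p x * a' x * a x) * ?c x))
      + phase (- \<i>) x * (- (?d x - L2) - \<i> * (of_real (p x * a' x * a x) * ?d x))) \<longlongrightarrow> 0) at_top"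
      by (intro tendsto_add_zero tendsto_zero_phase) auto
    fix x assume x: "x \<ge> x0"
    have "x > 0" using x x0_pos by simp
    have nz: "complex_of_real (a x) \<noteq> 0" "complex_of_real (p x) \<noteq> 0"
      using a_pos[OF x] pq_pos[OF x] by auto
    \<comment> \<open>By \<open>\<xi> a = 1 / (p a)\<close>, dividing the formula for \<open>v\<close> by \<open>p\<close> produces the prefactor
      \<open>\<i> \<xi> a\<close>; the contribution of \<open>p a' u / a\<close> becomes a multiple of \<open>p a' a\<close> and is absorbed
      into the error term.\<close>
    have eq: "complex_of_real (xi p q x) = 1 / (of_real (p x) * (of_real (a x))\<^sup>2)"
      using xi_eq[OF x] by simp
    have alg: "(P * A' * (A * (C * E + D * E')) + \<i> * (C * E - D * E')) / A / P =
        \<i> * (1 / (P * A\<^sup>2)) * A * (L1 * E - L2 * E' + (E * ((C - L1) - \<i> * (P * A' * A * C))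
         + E' * (- (D - L2) - \<i> * (P * A' * A * D))))"
      if "A \<noteq> 0" "P \<noteq> 0" for P A A' C D E E' :: complex
      using that by (simp add: field_simps power2_eq_square)
    have "vector_derivative u (at x) = ?v x / of_real (p x)"
      by (rule vector_derivative_quasi[OF \<open>x > 0\<close>])
    also have "\<dots> = (of_real (p x) * of_real (a' x) *
        (of_real (a x) * (?c x * phase \<i> x + ?d x * phase (- \<i>) x)) +
           \<i> * (?c x * phase \<i> x - ?d x * phase (- \<i>) x)) / of_real (a x) / of_real (p x)"
      by (subst reconstruct(2)[OF x, where u = u and v = ?v],
          subst reconstruct(1)[OF x, where u = u and v = ?v]) simp
    also have "\<dots> = \<i> * of_real (xi p q x) * of_real (a x) *
      (L1 * phase \<i> x - L2 * phase (- \<i>) x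
        + (phase \<i> x * ((?c x - L1) - \<i> * (of_real (p x * a' x * a x) * ?c x))
      + phase (- \<i>) x * (- (?d x - L2) - \<i> * (of_real (p x * a' x * a x) * ?d x))))"
      unfolding eq using alg[OF nz] by simp
    finally show "vector_derivative u (at x) = \<i> * of_real (xi p q x) * of_real (a x) *
      (L1 * exp (\<i> * of_real (Xi p q x0 x)) - L2 * exp (- \<i> * of_real (Xi p q x0 x))
        + (phase \<i> x * ((?c x - L1) - \<i> * (of_real (p x * a' x * a x) * ?c x))
      + phase (- \<i>) x * (- (?d x - L2) - \<i> * (of_real (p x * a' x * a x) * ?d x))))"
      unfolding phase_def .
  qed
qed

section \<open>The Jost solution\<close>

lemma is_jostI:
  assumes s: "solution p q z u"
    and L1: "(coef \<i> u (quasi_deriv u) \<longlongrightarrow> 1) at_top"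
    and L2: "(coef (- \<i>) u (quasi_deriv u) \<longlongrightarrow> 0) at_top"
  shows "is_jost p q x0 z u"
proof -
  let ?e = "\<lambda>x. exp (\<i> * of_real (Xi p q x0 x))"
  have factor: "?e x * (1 + phase (- \<i>) x * w) = 1 * ?e x + 0 * exp (- \<i> * of_real (Xi p q x0 x)) + w"
    "?e x * (1 + phase (- \<i>) x * w) = 1 * ?e x - 0 * exp (- \<i> * of_real (Xi p q x0 x)) + w" for x w
    using phase_inverse[of x] by (simp_all add: phase_def algebra_simps flip: mult.assoc)
  obtain \<epsilon> where \<epsilon>: "(\<epsilon> \<longlongrightarrow> 0) at_top" "\<And>x. x \<ge> x0 \<Longrightarrow> u x = of_real (a x) *
      (1 * ?e x + 0 * exp (- \<i> * of_real (Xi p q x0 x)) + \<epsilon> x)"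
    using solution_asymptotics(1)[OF s L1 L2] by blast
  obtain \<epsilon>' where \<epsilon>': "(\<epsilon>' \<longlongrightarrow> 0) at_top" "\<And>x. x \<ge> x0 \<Longrightarrow> vector_derivative u (at x) =
      \<i> * of_real (xi p q x) * of_real (a x) *
      (1 * ?e x - 0 * exp (- \<i> * of_real (Xi p q x0 x)) + \<epsilon>' x)"
    using solution_asymptotics(2)[OF s L1 L2] by blast
  show ?thesis
    unfolding is_jost_def
  proof (intro conjI s)
    show "\<exists>\<epsilon>. (\<epsilon> \<longlongrightarrow> 0) at_top \<and> (\<forall>x\<ge>x0. u x = of_real (a x) * ?e x * (1 + \<epsilon> x))"
    proof (intro exI[of _ "\<lambda>x. phase (- \<i>) x * \<epsilon> x"] conjI allI impI)
      show "((\<lambda>x. phase (- \<i>) x * \<epsilon> x) \<longlongrightarrow> 0) at_top"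
        using \<epsilon>(1) by (auto intro: tendsto_zero_phase)
      show "u x = of_real (a x) * ?e x * (1 + phase (- \<i>) x * \<epsilon> x)" if "x \<ge> x0" for x
        unfolding mult.assoc factor(1) by (rule \<epsilon>(2)[OF that])
    qed
    show "\<exists>\<epsilon>. (\<epsilon> \<longlongrightarrow> 0) at_top \<and> (\<forall>x\<ge>x0. vector_derivative u (at x) =
        \<i> * of_real (xi p q x) * of_real (a x) * ?e x * (1 + \<epsilon> x))"
    proof (intro exI[of _ "\<lambda>x. phase (- \<i>) x * \<epsilon>' x"] conjI allI impI)
      show "((\<lambda>x. phase (- \<i>) x * \<epsilon>' x) \<longlongrightarrow> 0) at_top"
        using \<epsilon>'(1) by (auto intro: tendsto_zero_phase)
      show "vector_derivative u (at x) =
          \<i> * of_real (xi p q x) * of_real (a x) * ?e x * (1 + phase (- \<i>) x * \<epsilon>' x)"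
        if "x \<ge> x0" for x
        unfolding mult.assoc factor(2) using \<epsilon>'(2)[OF that] by (simp only: mult.assoc)
    qed
  qed
qed

text \<open>
  The converse of the previous lemma: the asymptotics of \<open>u\<close> and \<open>u'\<close> in the definition of a Jost
  solution are inserted into the formula for the coefficients. Multiplication by a phase
  preserves convergence to zero, which handles the oscillating factor left in \<open>c\<^sub>-\<close>.
\<close>

lemma is_jostD:
  assumes "is_jost p q x0 z u"
  shows "solution p q z u"
    and "(coef \<i> u (quasi_deriv u) \<longlongrightarrow> 1) at_top"
    and "(coef (- \<i>) u (quasi_deriv u) \<longlongrightarrow> 0) at_top"
proof -
  let ?e = "\<lambda>x. exp (\<i> * of_real (Xi p q x0 x))"
  let ?v = "quasi_deriv u"
  show s: "solution p q z u" using assms by (simp add: is_jost_def)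
  obtain \<epsilon> where \<epsilon>: "(\<epsilon> \<longlongrightarrow> 0) at_top" "\<And>x. x \<ge> x0 \<Longrightarrow> u x = of_real (a x) * ?e x * (1 + \<epsilon> x)"
    using assms unfolding is_jost_def by blast
  obtain \<epsilon>' where \<epsilon>': "(\<epsilon>' \<longlongrightarrow> 0) at_top" "\<And>x. x \<ge> x0 \<Longrightarrow> vector_derivative u (at x) =
      \<i> * of_real (xi p q x) * of_real (a x) * ?e x * (1 + \<epsilon>' x)"
    using assms unfolding is_jost_def by blast
  let ?Q = "\<lambda>x. complex_of_real (p x * a' x * a x)"
  have P0: "(?Q \<longlongrightarrow> 0) at_top"
    using tendsto_of_real[OF paa'_lim, where 'a = complex] by simp
  have coef: "coef j u ?v x = phase (- j) x *
      (phase \<i> x * ((1 + \<epsilon> x) + j * (?Q x * (1 + \<epsilon> x) - \<i> * (1 + \<epsilon>' x)))) / 2"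
    if x: "x \<ge> x0" for x j
  proof -
    have "x > 0" using x x0_pos by simp
    have nz: "complex_of_real (a x) \<noteq> 0" "complex_of_real (p x) \<noteq> 0"
      using a_pos[OF x] pq_pos[OF x] by auto
    have eq: "complex_of_real (xi p q x) = 1 / (of_real (p x) * (of_real (a x))\<^sup>2)"
      using xi_eq[OF x] by simp
    have v: "of_real (a x) * ?v x = \<i> * phase \<i> x * (1 + \<epsilon>' x)"
      unfolding quasi_deriv_def \<epsilon>'(2)[OF x] eq phase_def using nz
      by (simp add: field_simps power2_eq_square)
    have 1: "u x * of_real (inverse (a x)) = phase \<i> x * (1 + \<epsilon> x)"
      unfolding \<epsilon>(2)[OF x] phase_def[symmetric] using nz by (simp add: field_simps)
    have 2: "of_real (p x * a' x) * u x = phase \<i> x * (?Q x * (1 + \<epsilon> x))"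
      unfolding \<epsilon>(2)[OF x] phase_def[symmetric] by (simp add: algebra_simps)
    have "u x * of_real (inverse (a x)) + j * (of_real (p x * a' x) * u x - of_real (a x) * ?v x)
        = phase \<i> x * ((1 + \<epsilon> x) + j * (?Q x * (1 + \<epsilon> x) - \<i> * (1 + \<epsilon>' x)))"
      unfolding v 1 2 by (simp add: algebra_simps)
    then show ?thesis unfolding coef_def by (simp only:)
  qed
  have "((\<lambda>x. ((1 + \<epsilon> x) + \<i> * (?Q x * (1 + \<epsilon> x) - \<i> * (1 + \<epsilon>' x))) / 2)
     \<longlongrightarrow> ((1 + 0) + \<i> * (0 * (1 + 0) - \<i> * (1 + 0))) / 2) at_top"
    by (intro tendsto_intros P0 \<epsilon>(1) \<epsilon>'(1)) simp
  then have 1: "((\<lambda>x. ((1 + \<epsilon> x) + \<i> * (?Q x * (1 + \<epsilon> x) - \<i> * (1 + \<epsilon>' x))) / 2) \<longlongrightarrow> 1) at_top"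
    by simp
  show "(coef \<i> u ?v \<longlongrightarrow> 1) at_top"
  proof (rule Lim_transform_eventually[OF 1])
    show "\<forall>\<^sub>F x in at_top. ((1 + \<epsilon> x) + \<i> * (?Q x * (1 + \<epsilon> x) - \<i> * (1 + \<epsilon>' x))) / 2 = coef \<i> u ?v x"
      using eventually_ge_at_top[of x0]
    proof eventually_elim
      case (elim x)
      have "phase (- \<i>) x * phase \<i> x = 1"
        using phase_inverse[of x] by (simp only: mult.commute)
      then have "phase (- \<i>) x * (phase \<i> x * w) = w" for w
        by (simp only: mult.assoc[symmetric] mult_1)
      then show ?case by (simp only: coef[OF elim])
    qed
  qed
  have "((\<lambda>x. ((1 + \<epsilon> x) + - \<i> * (?Q x * (1 + \<epsilon> x) - \<i> * (1 + \<epsilon>' x))) / 2)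
     \<longlongrightarrow> ((1 + 0) + - \<i> * (0 * (1 + 0) - \<i> * (1 + 0))) / 2) at_top"
    by (intro tendsto_intros P0 \<epsilon>(1) \<epsilon>'(1)) simp
  then have "((\<lambda>x. ((1 + \<epsilon> x) + - \<i> * (?Q x * (1 + \<epsilon> x) - \<i> * (1 + \<epsilon>' x))) / 2) \<longlongrightarrow> 0) at_top"
    by simp
  then have 2: "((\<lambda>x. phase \<i> x * (phase \<i> x * (((1 + \<epsilon> x) + - \<i> * (?Q x * (1 + \<epsilon> x) - \<i> * (1 + \<epsilon>' x))) / 2))) \<longlongrightarrow> 0) at_top"
    by (intro tendsto_zero_phase) auto
  show "(coef (- \<i>) u ?v \<longlongrightarrow> 0) at_top"
  proof (rule Lim_transform_eventually[OF 2])
    show "\<forall>\<^sub>F x in at_top. phase \<i> x * (phase \<i> x * (((1 + \<epsilon> x) + - \<i> * (?Q x * (1 + \<epsilon> x) - \<i> * (1 + \<epsilon>' x))) / 2))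
        = coef (- \<i>) u ?v x"
      using eventually_ge_at_top[of x0]
      by eventually_elim (simp only: coef minus_minus times_divide_eq_right)
  qed
qed

text \<open>
  Existence: the limits \<open>(c1, d1)\<close> and \<open>(c2, d2)\<close> of a fundamental system have nonzero determinant
  because their Wronskian is nonzero, so a linear combination has the limits \<open>(1, 0)\<close>.
  Uniqueness: the difference of two Jost solutions has the limits \<open>(0, 0)\<close>, so its Wronskians
  with the fundamental system vanish.
\<close>

lemma jost_unique: "\<exists>!f. is_jost p q x0 z f"
proof -
  obtain u1 v1 u2 v2 where 1: "system z u1 v1" "(u1 \<longlongrightarrow> 1) (at_right 0)" "(v1 \<longlongrightarrow> 0) (at_right 0)"
    and 2: "system z u2 v2" "(u2 \<longlongrightarrow> 0) (at_right 0)" "(v2 \<longlongrightarrow> 1) (at_right 0)"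
    and W: "\<And>x. x > 0 \<Longrightarrow> wronskian u1 v1 u2 v2 x = 1"
    using fundamental_system by blast
  obtain c1 d1 where L1: "(coef \<i> u1 v1 \<longlongrightarrow> c1) at_top" "(coef (- \<i>) u1 v1 \<longlongrightarrow> d1) at_top"
    using coef_convergent[OF 1(1)] by blast
  obtain c2 d2 where L2: "(coef \<i> u2 v2 \<longlongrightarrow> c2) at_top" "(coef (- \<i>) u2 v2 \<longlongrightarrow> d2) at_top"
    using coef_convergent[OF 2(1)] by blast
  define D where "D = c1 * d2 - d1 * c2"
  have "D \<noteq> 0"
    using wronskian_limits[OF 1(1) 2(1) L1 L2, of 1] W[of 1] by (auto simp: D_def)
  define u v where "u x = d2 / D * u1 x + - d1 / D * u2 x"
    and "v x = d2 / D * v1 x + - d1 / D * v2 x" for x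
  have uv: "system z u v" unfolding u_def v_def by (rule system_lincomb[OF 1(1) 2(1)])
  have "(coef \<i> u v \<longlongrightarrow> d2 / D * c1 + - d1 / D * c2) at_top"
    unfolding u_def v_def by (rule coef_lincomb_tendsto[OF L1(1) L2(1)])
  moreover have "d2 / D * c1 + - d1 / D * c2 = 1"
    using \<open>D \<noteq> 0\<close> by (simp add: field_simps) (simp add: D_def algebra_simps)
  ultimately have lim1: "(coef \<i> u v \<longlongrightarrow> 1) at_top" by simp
  have "(coef (- \<i>) u v \<longlongrightarrow> d2 / D * d1 + - d1 / D * d2) at_top"
    unfolding u_def v_def by (rule coef_lincomb_tendsto[OF L1(2) L2(2)])
  then have lim2: "(coef (- \<i>) u v \<longlongrightarrow> 0) at_top" by simp
  let ?f = "restrict u {0<..}"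
  have f: "system z ?f v" by (rule system_cong[OF uv]) auto
  have ex: "is_jost p q x0 z ?f"
  proof (rule is_jostI)
    show "solution p q z ?f" by (rule system_solution[OF uv])
    show "(coef \<i> ?f (quasi_deriv ?f) \<longlongrightarrow> 1) at_top"
      by (rule coef_tendsto_cong[OF _ _ lim1]) (auto simp: system_quasi_deriv[OF f])
    show "(coef (- \<i>) ?f (quasi_deriv ?f) \<longlongrightarrow> 0) at_top"
      by (rule coef_tendsto_cong[OF _ _ lim2]) (auto simp: system_quasi_deriv[OF f])
  qed
  show ?thesis
  proof (rule ex1I, rule ex)
    fix g assume g: "is_jost p q x0 z g"
    note F = is_jostD[OF ex] and G = is_jostD[OF g]
    note sF = solution_system[OF F(1)] and sG = solution_system[OF G(1)]
    define y where "y x = 1 * g x + (-1) * ?f x" for x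
    define w where "w x = 1 * quasi_deriv g x + (-1) * quasi_deriv ?f x" for x
    have yw: "system z y w" unfolding y_def w_def by (rule system_lincomb[OF sG sF])
    have lim0: "(coef \<i> y w \<longlongrightarrow> 0) at_top" "(coef (- \<i>) y w \<longlongrightarrow> 0) at_top"
      using coef_lincomb_tendsto[OF G(2) F(2), of 1 "-1"] coef_lincomb_tendsto[OF G(3) F(3), of 1 "-1"]
      by (simp_all add: y_def[abs_def] w_def[abs_def])
    have W1: "wronskian y w u2 v2 x = 0" if "x > 0" for x
      using wronskian_limits[OF yw 2(1) lim0 L2 that] by simp
    have W2: "wronskian u1 v1 y w x = 0" if "x > 0" for x
      using wronskian_limits[OF 1(1) yw L1 lim0 that] by simp
    have "y x = 0" if "x > 0" for x
      using fundamental_system_expansion[OF W _ W1 W2 that] by simp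
    then show "g = ?f"
      using F(1) G(1) by (intro extensionalityI[of _ "{0<..}"]) (auto simp: y_def solution_def)
  qed
qed

lemma is_jost_jost: "is_jost p q x0 z (jost p q x0 z)"
  unfolding jost_def by (rule theI'[OF jost_unique])

lemmas jost_solution = is_jostD(1)[OF is_jost_jost]
  and jost_limits = is_jostD(2,3)[OF is_jost_jost]

text \<open>
  Conjugation exchanges the two coefficients because it exchanges the two phases.
\<close>

lemma jost_cnj:
  fixes z defines "g \<equiv> \<lambda>x. cnj (jost p q x0 (cnj z) x)"
    and "w \<equiv> \<lambda>x. cnj (quasi_deriv (jost p q x0 (cnj z)) x)"
  shows "system z g w" "(coef \<i> g w \<longlongrightarrow> 0) at_top" "(coef (- \<i>) g w \<longlongrightarrow> 1) at_top"
proof -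
  show "system z g w"
    unfolding g_def w_def by (rule system_cnj[OF solution_system[OF jost_solution]])
  have coef: "coef j g w = (\<lambda>x. cnj (coef (cnj j) (jost p q x0 (cnj z))
      (quasi_deriv (jost p q x0 (cnj z))) x))" for j
    unfolding g_def w_def by (rule ext) (rule coef_cnj)
  show "(coef \<i> g w \<longlongrightarrow> 0) at_top" "(coef (- \<i>) g w \<longlongrightarrow> 1) at_top"
    using tendsto_cnj[OF jost_limits(2)[of "cnj z"]] tendsto_cnj[OF jost_limits(1)[of "cnj z"]]
    unfolding coef by simp_all
qed

text \<open>
  The limits of the coefficients recover the constants of an expansion in Jost solutions; in
  particular such an expansion is unique.
\<close>

lemma jost_combination_limits:
  assumes "system z u v"
    and u: "\<And>x. x > 0 \<Longrightarrow> u x = c * jost p q x0 z x + d * cnj (jost p q x0 (cnj z) x)"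
  shows "(coef \<i> u v \<longlongrightarrow> c) at_top" "(coef (- \<i>) u v \<longlongrightarrow> d) at_top"
proof -
  define f g where "f = jost p q x0 z" and "g x = cnj (jost p q x0 (cnj z) x)" for x
  define w where "w x = cnj (quasi_deriv (jost p q x0 (cnj z)) x)" for x
  note G = jost_cnj[of z, folded g_def w_def]
  have f: "system z f (quasi_deriv f)" unfolding f_def by (intro solution_system jost_solution)
  let ?y = "\<lambda>x. c * f x + d * g x" and ?w = "\<lambda>x. c * quasi_deriv f x + d * w x"
  have s: "system z ?y ?w" by (rule system_lincomb[OF f G(1)])
  have "system z u ?w" by (rule system_cong[OF s]) (auto simp: u f_def g_def)
  then have v: "v x = ?w x" if "x > 0" for x
    using system_quasi_deriv[OF \<open>system z u ?w\<close> that] system_quasi_deriv[OF assms(1) that] by simp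
  have u': "?y x = u x" "?w x = v x" if "x > 0" for x
    using u[OF that] v[OF that] by (simp_all only: f_def g_def)
  have "(coef \<i> ?y ?w \<longlongrightarrow> c * 1 + d * 0) at_top"
    unfolding f_def by (rule coef_lincomb_tendsto[OF jost_limits(1) G(2)])
  from coef_tendsto_cong[OF u' this] show "(coef \<i> u v \<longlongrightarrow> c) at_top"
    by simp
  have "(coef (- \<i>) ?y ?w \<longlongrightarrow> c * 0 + d * 1) at_top"
    unfolding f_def by (rule coef_lincomb_tendsto[OF jost_limits(2) G(3)])
  from coef_tendsto_cong[OF u' this] show "(coef (- \<i>) u v \<longlongrightarrow> d) at_top"
    by simp
qed

text \<open>
  The limits \<open>(1, 0)\<close> and \<open>(0, 1)\<close> give the two Jost solutions the Wronskian \<open>-2\<i>\<close>, so every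
  solution is a linear combination of them.
\<close>

lemma jost_coeffs_limits:
  assumes "solution p q z u"
  shows "(coef \<i> u (quasi_deriv u) \<longlongrightarrow> fst (jost_coeffs p q x0 z u)) at_top"
    and "(coef (- \<i>) u (quasi_deriv u) \<longlongrightarrow> snd (jost_coeffs p q x0 z u)) at_top"
proof -
  let ?f = "jost p q x0 z" and ?g = "\<lambda>x. cnj (jost p q x0 (cnj z) x)"
  let ?P = "\<lambda>c. \<forall>x>0. u x = fst c * ?f x + snd c * ?g x"
  define w where "w x = cnj (quasi_deriv (jost p q x0 (cnj z)) x)" for x
  note G = jost_cnj[of z, folded w_def]
  note s = solution_system[OF assms]
  have f: "system z ?f (quasi_deriv ?f)" by (intro solution_system jost_solution)
  have W: "wronskian ?f (quasi_deriv ?f) ?g w x = - 2 * \<i>" if "x > 0" for x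
    using wronskian_limits[OF f G(1) jost_limits G(2,3) that] by simp
  obtain w1 where w1: "\<And>x. x > 0 \<Longrightarrow> wronskian u (quasi_deriv u) ?g w x = w1"
    using wronskian_constant[OF s G(1)] by blast
  obtain w2 where w2: "\<And>x. x > 0 \<Longrightarrow> wronskian ?f (quasi_deriv ?f) u (quasi_deriv u) x = w2"
    using wronskian_constant[OF f s] by blast
  have nz: "- 2 * \<i> \<noteq> 0" by simp
  have ex: "?P (w1 / (- 2 * \<i>), w2 / (- 2 * \<i>))"
  proof (intro allI impI)
    fix x :: real assume "x > 0"
    have "u x = w1 / (- 2 * \<i>) * ?f x + w2 / (- 2 * \<i>) * ?g x"
      by (rule fundamental_system_expansion[OF W nz w1 w2 \<open>x > 0\<close>])
    then show "u x = fst (w1 / (- 2 * \<i>), w2 / (- 2 * \<i>)) * ?f x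
        + snd (w1 / (- 2 * \<i>), w2 / (- 2 * \<i>)) * ?g x"
      by (simp only: fst_conv snd_conv)
  qed
  have "(coef \<i> u (quasi_deriv u) \<longlongrightarrow> w1 / (- 2 * \<i>)) at_top"
    "(coef (- \<i>) u (quasi_deriv u) \<longlongrightarrow> w2 / (- 2 * \<i>)) at_top"
    by (rule jost_combination_limits[OF s ex[unfolded fst_conv snd_conv, rule_format]]; assumption)+
  note B = this
  have "\<exists>!c. ?P c"
  proof (rule ex1I, rule ex)
    fix c assume c: "?P c"
    have A: "(coef \<i> u (quasi_deriv u) \<longlongrightarrow> fst c) at_top"
      "(coef (- \<i>) u (quasi_deriv u) \<longlongrightarrow> snd c) at_top"
      by (rule jost_combination_limits[OF s c[rule_format]]; assumption)+
    have "fst c = w1 / (- 2 * \<i>)"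
      by (rule tendsto_unique[OF trivial_limit_at_top_linorder A(1) B(1)])
    moreover have "snd c = w2 / (- 2 * \<i>)"
      by (rule tendsto_unique[OF trivial_limit_at_top_linorder A(2) B(2)])
    ultimately show "c = (w1 / (- 2 * \<i>), w2 / (- 2 * \<i>))" by (simp add: prod_eq_iff)
  qed
  then have "?P (jost_coeffs p q x0 z u)"
    unfolding jost_coeffs_def by (rule theI')
  with jost_combination_limits[OF s, of "fst (jost_coeffs p q x0 z u)" "snd (jost_coeffs p q x0 z u)"]
  show "(coef \<i> u (quasi_deriv u) \<longlongrightarrow> fst (jost_coeffs p q x0 z u)) at_top"
    "(coef (- \<i>) u (quasi_deriv u) \<longlongrightarrow> snd (jost_coeffs p q x0 z u)) at_top"
    by blast+
qed

end

theorem theorem2p6: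
  fixes p q a' h :: "real \<Rightarrow> real" and x0 :: real and \<alpha> :: boundary_param
  assumes p_C1: "p C1_differentiable_on {0<..}"
    and q_cont: "continuous_on {0<..} q"
    and p_lim: "(p \<longlongrightarrow> p 0) (at_right 0)"
    and q_lim: "(q \<longlongrightarrow> q 0) (at_right 0)"
    and p_pos: "\<forall>x\<ge>0. p x > 0"
    and x0_pos: "x0 > 0"
    and q_pos: "\<forall>x\<ge>x0. q x > 0"
    and a_deriv: "\<forall>x\<ge>x0. (amp p q has_real_derivative a' x) (at x within {x0..})"
    and a'_cont: "continuous_on {x0..} a'"
    and a'_ac: "locally_abs_continuous_on {x0..} a'"
    and pa'_deriv: "has_ae_derivative_on (\<lambda>x. p x * a' x) h {x0<..}"
    and a_L2: "set_integrable lebesgue {x0<..} (\<lambda>x. (amp p q x)\<^sup>2)"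
    and apa'_L1: "set_integrable lebesgue {x0<..} (\<lambda>x. amp p q x * h x)"
    and paa'_lim: "((\<lambda>x. p x * a' x * amp p q x) \<longlongrightarrow> 0) at_top"
  shows "\<forall>z :: complex.
    (\<exists>\<epsilon>. (\<epsilon> \<longlongrightarrow> 0) at_top \<and> (\<forall>x\<ge>x0.
       phi p q \<alpha> z x = of_real (amp p q x) *
         (sigma_plus p q x0 \<alpha> z * exp (\<i> * of_real (Xi p q x0 x)) +
          sigma_minus p q x0 \<alpha> z * exp (- \<i> * of_real (Xi p q x0 x)) + \<epsilon> x))) \<and>
    (\<exists>\<epsilon>. (\<epsilon> \<longlongrightarrow> 0) at_top \<and> (\<forall>x\<ge>x0.
       theta p q \<alpha> z x = of_real (amp p q x) *
         (tau_plus p q x0 \<alpha> z * exp (\<i> * of_real (Xi p q x0 x)) +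
          tau_minus p q x0 \<alpha> z * exp (- \<i> * of_real (Xi p q x0 x)) + \<epsilon> x))) \<and>
    (\<exists>\<epsilon>. (\<epsilon> \<longlongrightarrow> 0) at_top \<and> (\<forall>x\<ge>x0.
       vector_derivative (phi p q \<alpha> z) (at x) = \<i> * of_real (xi p q x) * of_real (amp p q x) *
         (sigma_plus p q x0 \<alpha> z * exp (\<i> * of_real (Xi p q x0 x)) -
          sigma_minus p q x0 \<alpha> z * exp (- \<i> * of_real (Xi p q x0 x)) + \<epsilon> x))) \<and>
    (\<exists>\<epsilon>. (\<epsilon> \<longlongrightarrow> 0) at_top \<and> (\<forall>x\<ge>x0.
       vector_derivative (theta p q \<alpha> z) (at x) = \<i> * of_real (xi p q x) * of_real (amp p q x) *
         (tau_plus p q x0 \<alpha> z * exp (\<i> * of_real (Xi p q x0 x)) -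
          tau_minus p q x0 \<alpha> z * exp (- \<i> * of_real (Xi p q x0 x)) + \<epsilon> x)))"
proof -
  interpret liouville_green p q a' h x0
    by unfold_locales (fact assms)+
  show ?thesis
    unfolding sigma_plus_def sigma_minus_def tau_plus_def tau_minus_def
    by (intro allI conjI
        solution_asymptotics[OF phi_solution jost_coeffs_limits(1)[OF phi_solution]
          jost_coeffs_limits(2)[OF phi_solution]]
        solution_asymptotics[OF theta_solution jost_coeffs_limits(1)[OF theta_solution]
          jost_coeffs_limits(2)[OF theta_solution]])
qed

end
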